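(* Let $R\in\{\mathbf{L},\mathbf{H}\}$ and let $S \subsetneq R$ be reduced (with respect to $R$) and such that $|S| \geq 2$. Let $\Delta(S) = \{\alpha-\beta \mid \alpha, \beta \in S\}$ and let $\Gamma(S) = \gcd(\{N(\delta) \mid \delta \in \Delta(S)\})$. (1) Assume $R = \mathbf{L}$. Then $S$ is a ringset if and only if $\Gamma(S)=2$; or $\Gamma(S)=4$; or $\Gamma(S)=8$ and the following condition holds: there exist $\delta_1, \delta_2 \in \Delta(S)$ such that $\delta_1$ and $\delta_2$ are congruent modulo $4$ (i.e. modulo $4\mathbf{L}$) to distinct residues in $\{2\mathbf{i}+2\mathbf{j},\ 2\mathbf{i}+2\mathbf{k},\ 2\mathbf{j}+2\mathbf{k}\}$. (2) Assume $R = \mathbf{H}$. Then $S$ is a ringset if and only if $\Gamma(S)=1$ or $\Gamma(S) = 2$.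
   Context: Let $\mathbb{D}=\{a_0+a_1\mathbf{i}+a_2\mathbf{j}+a_3\mathbf{k} \mid a_0,\dots,a_3\in\mathbb{Q}\}$ be the division ring of rational quaternions, with $\mathbf{i}^2=\mathbf{j}^2=-1$ and $\mathbf{i}\mathbf{j}=\mathbf{k}=-\mathbf{j}\mathbf{i}$. Let $\mathbf{L}$ (Lipschitz quaternions) be the subring of elements with all $a_i\in\mathbb{Z}$, and $\mathbf{H}$ (Hurwitz quaternions) the subring of elements with either all $a_i\in\mathbb{Z}$ or all $a_i\in\mathbb{Z}+\frac12$. In $\mathbb{D}[x]$ the indeterminate $x$ is central, and polynomials are evaluated with coefficients on the left: for $f=\sum_i a_i x^i$ and $\alpha\in\mathbb{D}$, $f(\alpha)=\sum_i a_i\alpha^i$. For $S\subseteq R$, $\mathrm{Int}(S,R)=\{f\in\mathbb{D}[x]\mid f(S)\subseteq R\}$, and $S$ is a ringset (of $R$) if $\mathrm{Int}(S,R)$ is a subring of $\mathbb{D}[x]$. For $\alpha=a_0+a_1\mathbf{i}+a_2\mathbf{j}+a_3\mathbf{k}$, the norm is $N(\alpha)=a_0^2+a_1^2+a_2^2+a_3^2$. The minimal polynomial $\mu_\alpha$ of $\alpha$ is $x-\alpha$ if $\alpha\in\mathbb{Q}$, and $x^2-2a_0x+N(\alpha)$ if $\alpha\in\mathbb{D}\setminus\mathbb{Q}$. For $m\in\mathbb{Z}[x]$ monic of degree 1 or 2, $\mathcal{C}_R(m)=\{\alpha\in R\mid\mu_\alpha=m\}$. A subset $S\subseteq R$ is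 reduced (with respect to $R$) if (i) $S\subseteq\mathcal{C}_R(m)$ for some monic quadratic $m\in\mathbb{Z}[x]$, and (ii) for all $a\in\mathbb{Z}$ and all integers $n\geq2$, $S+a:=\{\alpha+a\mid\alpha\in S\}\not\subseteq nR$. *)

theory Defs
  imports Complex_Main "HOL-Library.Poly_Mapping" "HOL-Computational_Algebra.Polynomial"
begin

section \<open>The division ring of rational quaternions\<close>

datatype rquat = Quat (q0: rat) (q1: rat) (q2: rat) (q3: rat)

definition qi :: rquat where "qi = Quat 0 1 0 0"
definition qj :: rquat where "qj = Quat 0 0 1 0"
definition qk :: rquat where "qk = Quat 0 0 0 1"

definition qnorm :: "rquat \<Rightarrow> rat" where
  "qnorm a = (q0 a)\<^sup>2 + (q1 a)\<^sup>2 + (q2 a)\<^sup>2 + (q3 a)\<^sup>2"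

lemma qnorm_eq_0_iff: "qnorm a = 0 \<longleftrightarrow> a = Quat 0 0 0 0"
  by (cases a) (auto simp: qnorm_def add_nonneg_eq_0_iff)

instantiation rquat :: division_ring
begin

definition zero_rquat :: rquat where "0 = Quat 0 0 0 0"
definition one_rquat :: rquat where "1 = Quat 1 0 0 0"

definition plus_rquat :: "rquat \<Rightarrow> rquat \<Rightarrow> rquat" where
  "a + b = Quat (q0 a + q0 b) (q1 a + q1 b) (q2 a + q2 b) (q3 a + q3 b)"

definition uminus_rquat :: "rquat \<Rightarrow> rquat" where
  "- a = Quat (- q0 a) (- q1 a) (- q2 a) (- q3 a)"

definition minus_rquat :: "rquat \<Rightarrow> rquat \<Rightarrow> rquat" where
  "a - b = Quat (q0 a - q0 b) (q1 a - q1 b) (q2 a - q2 b) (q3 a - q3 b)"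

definition times_rquat :: "rquat \<Rightarrow> rquat \<Rightarrow> rquat" where
  "a * b = Quat
     (q0 a * q0 b - q1 a * q1 b - q2 a * q2 b - q3 a * q3 b)
     (q0 a * q1 b + q1 a * q0 b + q2 a * q3 b - q3 a * q2 b)
     (q0 a * q2 b - q1 a * q3 b + q2 a * q0 b + q3 a * q1 b)
     (q0 a * q3 b + q1 a * q2 b - q2 a * q1 b + q3 a * q0 b)"

definition inverse_rquat :: "rquat \<Rightarrow> rquat" where
  "inverse a =
     Quat (q0 a / qnorm a) (- q1 a / qnorm a) (- q2 a / qnorm a) (- q3 a / qnorm a)"

definition divide_rquat :: "rquat \<Rightarrow> rquat \<Rightarrow> rquat" where
  "a div b = a * inverse (b::rquat)"

instance
proof
  fix a :: rquat
  assume "a \<noteq> 0"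
  then have n: "qnorm a \<noteq> 0"
    by (simp add: qnorm_eq_0_iff zero_rquat_def)
  have d: "x / qnorm a * y = x * y / qnorm a" "y * (x / qnorm a) = x * y / qnorm a" for x y
    by simp_all
  show "inverse a * a = 1" "a * inverse a = 1"
    using n
    by (simp_all add: inverse_rquat_def times_rquat_def one_rquat_def d
          flip: add_divide_distrib diff_divide_distrib)
      (simp_all add: qnorm_def power2_eq_square)
qed (auto simp: zero_rquat_def one_rquat_def plus_rquat_def uminus_rquat_def minus_rquat_def
      times_rquat_def inverse_rquat_def divide_rquat_def algebra_simps qnorm_def)

end

lemma quaternion_relations:
  "qi * qi = - 1" "qj * qj = - 1" "qi * qj = qk" "qj * qi = - qk"
  by (simp_all add: qi_def qj_def qk_def times_rquat_def one_rquat_def uminus_rquat_def)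

definition lipschitz :: "rquat set" where
  "lipschitz = {a. q0 a \<in> \<int> \<and> q1 a \<in> \<int> \<and> q2 a \<in> \<int> \<and> q3 a \<in> \<int>}"

definition hurwitz :: "rquat set" where
  "hurwitz = {a. (q0 a \<in> \<int> \<and> q1 a \<in> \<int> \<and> q2 a \<in> \<int> \<and> q3 a \<in> \<int>) \<or>
     (q0 a - 1/2 \<in> \<int> \<and> q1 a - 1/2 \<in> \<int> \<and> q2 a - 1/2 \<in> \<int> \<and> q3 a - 1/2 \<in> \<int>)}"


section \<open>Integer-valued polynomials and ringsets\<close>

text \<open>
  Multiplication on \<^typ>\<open>'a poly\<close> needs commutative coefficients. The polynomial ring in a
  central indeterminate over the quaternions is instead taken to be the monoid ring
  \<open>nat \<Rightarrow>\<^sub>0 rquat\<close>, where \<open>Poly_Mapping.lookup f n\<close> is the coefficient of \<open>x ^ n\<close>; the next lemma shows that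
  its product is the usual one.
\<close>

type_synonym rquat_poly = "nat \<Rightarrow>\<^sub>0 rquat"

lemma lookup_times_rquat_poly:
  fixes f g :: rquat_poly
  shows "Poly_Mapping.lookup (f * g) n = (\<Sum>i\<le>n. Poly_Mapping.lookup f i * Poly_Mapping.lookup g (n - i))"
proof -
  have "(\<Sum>q. Poly_Mapping.lookup g q when n = l + q) = (Poly_Mapping.lookup g (n - l) when l \<le> n)" for l
  proof (cases "l \<le> n")
    case True
    then have "(\<lambda>q. Poly_Mapping.lookup g q when n = l + q) = (\<lambda>q. Poly_Mapping.lookup g q when n - l = q)"
      by (auto simp: when_def fun_eq_iff)
    then show ?thesis using True by (simp only: Sum_any_when_equal' when_simps)
  qed auto
  then have "Poly_Mapping.lookup (f * g) n = (\<Sum>l. (Poly_Mapping.lookup f l * Poly_Mapping.lookup g (n - l)) when l \<le> n)"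
    by (simp add: lookup_mult mult_when)
  also have "\<dots> = (\<Sum>l\<le>n. Poly_Mapping.lookup f l * Poly_Mapping.lookup g (n - l))"
    by (subst Sum_any.expand_superset[of "{..n}"]) (auto simp: when_def)
  finally show ?thesis .
qed

definition qeval :: "rquat_poly \<Rightarrow> rquat \<Rightarrow> rquat" where
  "qeval f a = (\<Sum>n\<in>Poly_Mapping.keys f. Poly_Mapping.lookup f n * a ^ n)"

definition Int_poly :: "rquat set \<Rightarrow> rquat set \<Rightarrow> rquat_poly set" where
  "Int_poly S R = {f. qeval f ` S \<subseteq> R}"

definition is_subring :: "'a::ring_1 set \<Rightarrow> bool" where
  "is_subring A \<longleftrightarrow> 1 \<in> A \<and> (\<forall>f\<in>A. \<forall>g\<in>A. f - g \<in> A \<and> f * g \<in> A)"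

definition ringset :: "rquat set \<Rightarrow> rquat set \<Rightarrow> bool" where
  "ringset R S \<longleftrightarrow> S \<subseteq> R \<and> is_subring (Int_poly S R)"


section \<open>Reduced sets\<close>

definition qminpoly :: "rquat \<Rightarrow> rat poly" where
  "qminpoly a = (if q1 a = 0 \<and> q2 a = 0 \<and> q3 a = 0 then [:- q0 a, 1:]
     else [:qnorm a, - 2 * q0 a, 1:])"

definition minpoly_class :: "rquat set \<Rightarrow> int poly \<Rightarrow> rquat set" where
  "minpoly_class R m = {a \<in> R. qminpoly a = map_poly of_int m}"

definition reduced :: "rquat set \<Rightarrow> rquat set \<Rightarrow> bool" where
  "reduced R S \<longleftrightarrow> S \<subseteq> R \<and>
     (\<exists>m::int poly. Polynomial.degree m = 2 \<and> lead_coeff m = 1 \<and> S \<subseteq> minpoly_class R m) \<and>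
     (\<forall>(a::int) (n::int). n \<ge> 2 \<longrightarrow>
        \<not> (\<lambda>s. s + of_int a) ` S \<subseteq> (\<lambda>r. of_int n * r) ` R)"

definition Delta :: "rquat set \<Rightarrow> rquat set" where
  "Delta S = {a - b | a b. a \<in> S \<and> b \<in> S}"

text \<open>
  Norms of Lipschitz and Hurwitz quaternions are nonnegative integers, so for subsets of these
  rings no norm is lost by collecting only the values that are natural numbers.
\<close>

definition Gamma :: "rquat set \<Rightarrow> nat" where
  "Gamma S = Gcd {n::nat. \<exists>d\<in>Delta S. qnorm d = of_nat n}"

definition cong_mod4_lipschitz :: "rquat \<Rightarrow> rquat \<Rightarrow> bool" where
  "cong_mod4_lipschitz a b \<longleftrightarrow> a - b \<in> (\<lambda>r. 4 * r) ` lipschitz"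

end

theory Submission
  imports Defs
begin

text \<open>
  Elements of a reduced set share a quadratic minimal polynomial with central coefficients, so
  every power \<open>a ^ n\<close> is \<open>p a + q\<close> with the same rational \<open>p\<close>, \<open>q\<close> for all \<open>a \<in> S\<close>. Hence a polynomial
  \<open>f\<close> acts on \<open>S\<close> as \<open>a \<mapsto> b a + c\<close>, and a product \<open>f g\<close> takes the value
  \<open>b g(a) a + c g(a) = b (g(a) a - a g(a)) + (b a + c) g(a)\<close>. Membership of \<open>f\<close> in
  \<open>Int(S, R)\<close> forces \<open>b \<Delta>(S) \<subseteq> R\<close>, and the value \<open>g(a)\<close> of an integer-valued \<open>g\<close> can be any
  element of \<open>R\<close>, since constants are allowed. So \<open>S\<close> is a ringset exactly when every multiplier,
  that is, every \<open>w\<close> with \<open>w \<Delta>(S) \<subseteq> R\<close>, also satisfies \<open>w (r a - a r) \<in> R\<close> for all \<open>r \<in> R\<close>, \<open>a \<in> S\<close>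
  (\<open>ringset_iff_multipliers\<close>).

  Necessity of the conditions: a forbidden divisor of \<open>\<Gamma>(S)\<close> produces a multiplier \<open>w\<close> with a
  denominator. Its effect on the commutators with \<open>i\<close>, \<open>j\<close>, \<open>k\<close>, whose coordinates are twice the
  imaginary coordinates of \<open>a\<close>, gives all these coordinates a common factor, against
  reducedness; in the Hurwitz ring at the prime 2 the commutator with \<open>(1 + i + j + k)/2\<close> is needed too
  and makes these coordinates congruent modulo 2, which suffices there. Norms of differences of
  Lipschitz quaternions of equal norm and real part are even, which excludes \<open>\<Gamma>(S) = 1\<close>. For an odd prime \<open>p\<close> the differences are isotropic and pairwise orthogonal
  modulo \<open>p\<close>, hence have vanishing cross products, and \<open>1/p\<close> or the conjugate of a difference,
  divided by \<open>p\<close>, is a multiplier (\<open>odd_prime_not_dvd_Gamma\<close>). For powers of two the multipliers are \<open>1/2\<close> (Hurwitz,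
  \<open>4 | \<Gamma>(S)\<close>), \<open>1/4\<close> (Lipschitz, \<open>16 | \<Gamma>(S)\<close>), and \<open>(i + j)/4\<close> or one of its two analogues
  (Lipschitz, \<open>8 | \<Gamma>(S)\<close>) when all differences lie in a single class modulo 4 besides 0.

  Sufficiency: \<open>w N(\<delta>)\<close> is \<open>w \<delta>\<close> times the conjugate of \<open>\<delta>\<close>, so \<open>\<Gamma>(S) w \<in> R\<close> for each multiplier. In the
  Hurwitz ring a difference of norm \<open>2 (2 h + 1)\<close> and any commutator both have even norm, and a
  product of two elements of even norm is divisible by 2; this absorbs the last factor 2. In the
  Lipschitz ring commutators are divisible by 2, and if \<open>4 | \<Gamma>(S)\<close> all differences are as well, which
  gives \<open>(\<Gamma>(S)/2) w \<in> R\<close> and settles \<open>\<Gamma>(S) \<le> 4\<close>. For \<open>\<Gamma>(S) = 8\<close> the two residues force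
  the coordinates of \<open>4 w\<close> to share one parity, and likewise the imaginary coordinates of every
  element of \<open>S\<close> (the latter because all norms agree); then \<open>4 w\<close> times half a commutator is
  divisible by 2.
\<close>

section \<open>Evaluation of products\<close>

lemma qeval_superset:
  assumes "finite A" and "Poly_Mapping.keys f \<subseteq> A"
  shows "qeval f a = (\<Sum>n\<in>A. Poly_Mapping.lookup f n * a ^ n)"
  unfolding qeval_def
  by (rule sum.mono_neutral_left) (use assms in \<open>auto simp: in_keys_iff\<close>)

lemma qeval_add: "qeval (f + g) a = qeval f a + qeval g a"
proof -
  let ?A = "Poly_Mapping.keys f \<union> Poly_Mapping.keys g"
  have "qeval (f + g) a = (\<Sum>n\<in>?A. Poly_Mapping.lookup (f + g) n * a ^ n)"
    by (rule qeval_superset) (use Poly_Mapping.keys_add[of f g] in auto)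
  also have "\<dots> = (\<Sum>n\<in>?A. Poly_Mapping.lookup f n * a ^ n) + (\<Sum>n\<in>?A. Poly_Mapping.lookup g n * a ^ n)"
    by (simp add: lookup_add distrib_right sum.distrib)
  also have "\<dots> = qeval f a + qeval g a"
    by (simp add: qeval_superset[of ?A f] qeval_superset[of ?A g])
  finally show ?thesis .
qed

lemma qeval_diff: "qeval (f - g) a = qeval f a - qeval g a"
  using qeval_add[of "f - g" g a] by (simp add: algebra_simps)

lemma qeval_single: "qeval (Poly_Mapping.single n c) a = c * a ^ n"
  by (subst qeval_superset[of "{n}"]) (auto simp: lookup_single)

lemma qeval_one: "qeval 1 a = 1"
  using qeval_single[of 0 1 a] by simp

lemma update_eq_single_add:
  assumes "k \<notin> Poly_Mapping.keys (f :: rquat_poly)"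
  shows "Poly_Mapping.update k c f = Poly_Mapping.single k c + f"
  by (rule poly_mapping_eqI)
    (use assms in \<open>auto simp: lookup_update lookup_add lookup_single when_def in_keys_iff\<close>)

lemma qeval_single_times: "qeval (Poly_Mapping.single k c * g) a = c * qeval g a * a ^ k"
proof (induction g rule: update_induct)
  case const
  then show ?case by (simp add: qeval_def)
next
  case (update g n b)
  then show ?case
    by (simp add: update_eq_single_add qeval_add distrib_left distrib_right qeval_single mult_single
        add.commute[of k] power_add mult.assoc)
qed

text \<open>
  Evaluation is not multiplicative over a noncommutative ring: for \<open>f g\<close> the value of \<open>g\<close> gets
  inserted between each coefficient of \<open>f\<close> and the power of \<open>a\<close>.
\<close>

definition two_sided_eval :: "rquat_poly \<Rightarrow> rquat \<Rightarrow> rquat \<Rightarrow> rquat" where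
  "two_sided_eval f a y = (\<Sum>n\<in>Poly_Mapping.keys f. Poly_Mapping.lookup f n * y * a ^ n)"

lemma qeval_eq_two_sided_eval: "qeval f a = two_sided_eval f a 1"
  by (simp add: qeval_def two_sided_eval_def)

lemma qeval_mult: "qeval (f * g) a = two_sided_eval f a (qeval g a)"
proof -
  have "f = (\<Sum>n\<in>Poly_Mapping.keys f. Poly_Mapping.single n (Poly_Mapping.lookup f n))"
    by (rule poly_mapping_eqI) (auto simp: lookup_sum lookup_single when_def in_keys_iff)
  then have "f * g = (\<Sum>n\<in>Poly_Mapping.keys f. Poly_Mapping.single n (Poly_Mapping.lookup f n) * g)"
    by (metis sum_distrib_right)
  moreover have "qeval (\<Sum>n\<in>A. h n) a = (\<Sum>n\<in>A. qeval (h n) a)" if "finite A"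
    for A and h :: "nat \<Rightarrow> rquat_poly"
    using that by (induction A) (auto simp: qeval_add, simp add: qeval_def)
  ultimately show ?thesis
    by (simp add: qeval_single_times two_sided_eval_def)
qed

section \<open>The multiplier criterion\<close>

lemmas quat_arith = zero_rquat_def one_rquat_def plus_rquat_def uminus_rquat_def minus_rquat_def
  times_rquat_def

definition scalar :: "rat \<Rightarrow> rquat" where
  "scalar x = Quat x 0 0 0"

lemma scalar_commutes: "scalar x * a = a * scalar x"
  by (simp add: scalar_def quat_arith)

lemma scalar_simps:
  "scalar (x + y) = scalar x + scalar y" "scalar (x - y) = scalar x - scalar y"
  "scalar (- x) = - scalar x" "scalar (x * y) = scalar x * scalar y" "scalar 0 = 0" "scalar 1 = 1"
  by (simp_all add: scalar_def quat_arith)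

lemma scalar_of_nat: "of_nat n = scalar (of_nat n)"
  by (induction n) (simp_all add: scalar_simps)

lemma scalar_of_int: "of_int n = scalar (of_int n)"
  by (cases n) (simp_all add: scalar_simps scalar_of_nat)

text \<open>
  The characteristic equation \<open>a\<^sup>2 = 2 t a - s\<close> has rational, hence central, coefficients, so one
  reduction serves all quaternions with real part \<open>t\<close> and norm \<open>s\<close>.
\<close>

lemma power_reduce:
  "\<exists>p q. \<forall>a. q0 a = t \<and> qnorm a = s \<longrightarrow> a ^ n = scalar p * a + scalar q"
proof (induction n)
  case 0
  show ?case by (rule exI[of _ 0], rule exI[of _ 1]) (simp add: scalar_simps)
next
  case (Suc n)
  then obtain p q where pq: "\<And>a. q0 a = t \<and> qnorm a = s \<Longrightarrow> a ^ n = scalar p * a + scalar q"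
    by blast
  have "a ^ Suc n = scalar (2 * t * p + q) * a + scalar (- s * p)" if "q0 a = t" "qnorm a = s" for a
  proof -
    have "a ^ Suc n = (scalar p * a + scalar q) * a"
      using pq[of a] that by (simp only: power_Suc2)
    also have "\<dots> = scalar (2 * t * p + q) * a + scalar (- s * p)"
      unfolding that[symmetric]
      by (cases a) (simp add: scalar_def quat_arith qnorm_def power2_eq_square algebra_simps)
    finally show ?thesis .
  qed
  then show ?case by blast
qed

text \<open>
  The scalars \<open>p\<close>, \<open>q\<close> from the reduction of powers commute with \<open>y\<close>. Keeping \<open>y\<close> free makes the same
  \<open>b\<close>, \<open>c\<close> describe both \<open>f\<close> (\<open>y = 1\<close>) and products \<open>f g\<close> (\<open>y = g(a)\<close>).
\<close>

lemma two_sided_eval_affine: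
  "\<exists>b c. \<forall>a y. q0 a = t \<and> qnorm a = s \<longrightarrow> two_sided_eval f a y = b * y * a + c * y"
proof -
  obtain p q where pq: "\<And>n a. q0 a = t \<and> qnorm a = s \<Longrightarrow> a ^ n = scalar (p n) * a + scalar (q n)"
    using power_reduce[of t s] by metis
  let ?b = "\<Sum>n\<in>Poly_Mapping.keys f. Poly_Mapping.lookup f n * scalar (p n)"
  let ?c = "\<Sum>n\<in>Poly_Mapping.keys f. Poly_Mapping.lookup f n * scalar (q n)"
  have "two_sided_eval f a y = ?b * y * a + ?c * y" if "q0 a = t" "qnorm a = s" for a y
  proof -
    have "Poly_Mapping.lookup f n * y * a ^ n
        = Poly_Mapping.lookup f n * scalar (p n) * y * a + Poly_Mapping.lookup f n * scalar (q n) * y" for n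
      using pq[of a n] that by (simp add: distrib_left mult.assoc) (metis mult.assoc scalar_commutes)
    then show ?thesis
      by (simp add: two_sided_eval_def sum_distrib_right sum.distrib)
  qed
  then show ?thesis by blast
qed

lemma is_subringD:
  assumes "is_subring R"
  shows "0 \<in> R" "1 \<in> R" "x \<in> R \<Longrightarrow> y \<in> R \<Longrightarrow> x + y \<in> R"
    "x \<in> R \<Longrightarrow> y \<in> R \<Longrightarrow> x - y \<in> R" "x \<in> R \<Longrightarrow> y \<in> R \<Longrightarrow> x * y \<in> R"
proof -
  show zero: "0 \<in> R" using assms by (metis is_subring_def diff_self)
  show "x + y \<in> R" if "x \<in> R" "y \<in> R"
  proof -
    have "x - (0 - y) \<in> R" using that zero assms unfolding is_subring_def by blast
    then show ?thesis by simp
  qed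
qed (use assms in \<open>auto simp: is_subring_def\<close>)

text \<open>
  This replaces polynomials by a condition on single quaternions. Forwards, \<open>f = w x - w a\<close> and the
  constant \<open>g = r\<close> have \<open>(f g)(a) = w (r a - a r)\<close>. Backwards, the linear coefficient \<open>b\<close> of the
  reduction of \<open>f\<close> is such a \<open>w\<close>, and \<open>(f g)(a) = b (g(a) a - a g(a)) + f(a) g(a)\<close>.
\<close>

lemma ringset_iff_multipliers:
  assumes subring_R: "is_subring R" and SR: "S \<subseteq> R"
    and tn: "\<And>a. a \<in> S \<Longrightarrow> q0 a = t \<and> qnorm a = s"
  shows "ringset R S \<longleftrightarrow>
    (\<forall>w. (\<forall>d\<in>Delta S. w * d \<in> R) \<longrightarrow> (\<forall>r\<in>R. \<forall>a\<in>S. w * (r * a - a * r) \<in> R))"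
    (is "_ \<longleftrightarrow> ?M")
proof
  assume ring: "ringset R S"
  show ?M
  proof (intro allI impI ballI)
    fix w r a
    assume w: "\<forall>d\<in>Delta S. w * d \<in> R" and r: "r \<in> R" and a: "a \<in> S"
    let ?f = "Poly_Mapping.single 1 w - Poly_Mapping.single 0 (w * a)"
    let ?g = "Poly_Mapping.single 0 r"
    have "qeval ?f b = w * (b - a)" for b
      by (simp add: qeval_diff qeval_single right_diff_distrib)
    then have "?f \<in> Int_poly S R"
      using w a by (auto simp: Int_poly_def Delta_def)
    moreover have "?g \<in> Int_poly S R"
      using r by (auto simp: Int_poly_def qeval_single)
    ultimately have "?f * ?g \<in> Int_poly S R"
      using ring by (simp add: ringset_def is_subring_def)
    then have "qeval (?f * ?g) a \<in> R"
      using a by (auto simp: Int_poly_def)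
    moreover have "qeval (?f * ?g) a = w * (r * a - a * r)"
      by (simp add: left_diff_distrib qeval_diff qeval_single_times qeval_single right_diff_distrib
          mult.assoc del: mult_1 flip: One_nat_def)
    ultimately show "w * (r * a - a * r) \<in> R" by simp
  qed
next
  assume M: ?M
  have "f * g \<in> Int_poly S R" if f: "f \<in> Int_poly S R" and g: "g \<in> Int_poly S R" for f g
  proof -
    obtain b c where bc: "\<And>a y. a \<in> S \<Longrightarrow> two_sided_eval f a y = b * y * a + c * y"
      using two_sided_eval_affine[of t s f] tn by blast
    have fa: "b * a + c \<in> R" if "a \<in> S" for a
      using f bc[OF that, of 1] that by (auto simp: Int_poly_def qeval_eq_two_sided_eval)
    have "b * d \<in> R" if "d \<in> Delta S" for d
    proof -
      from that obtain a a' where "a \<in> S" "a' \<in> S" "d = a - a'" by (auto simp: Delta_def)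
      then have "b * d = (b * a + c) - (b * a' + c)" by (simp add: right_diff_distrib)
      with fa \<open>a \<in> S\<close> \<open>a' \<in> S\<close> subring_R show ?thesis by (metis is_subring_def)
    qed
    with M have comm: "b * (r * a - a * r) \<in> R" if "r \<in> R" "a \<in> S" for r a
      using that by blast
    have "qeval (f * g) a \<in> R" if a: "a \<in> S" for a
    proof -
      have ga: "qeval g a \<in> R" using g a by (auto simp: Int_poly_def)
      have "qeval (f * g) a = b * (qeval g a * a - a * qeval g a) + (b * a + c) * qeval g a"
        by (simp add: qeval_mult bc[OF a] algebra_simps)
      then show ?thesis
        using comm[OF ga a] fa[OF a] ga subring_R by (simp add: is_subringD)
    qed
    then show ?thesis by (auto simp: Int_poly_def)
  qed
  moreover have "f - g \<in> Int_poly S R" if "f \<in> Int_poly S R" "g \<in> Int_poly S R" for f g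
    using that subring_R by (auto simp: Int_poly_def qeval_diff is_subring_def)
  moreover have "1 \<in> Int_poly S R"
    using subring_R by (auto simp: Int_poly_def qeval_one is_subring_def)
  ultimately show "ringset R S"
    using SR by (simp add: ringset_def is_subring_def)
qed

section \<open>Lipschitz and Hurwitz quaternions in integer coordinates\<close>

text \<open>
  Integer coordinates turn membership questions into parity and divisibility statements over \<^typ>\<open>int\<close>.
  The doubled coordinates of \<open>half\<close> cover both rings at once.
\<close>

definition lip :: "int \<Rightarrow> int \<Rightarrow> int \<Rightarrow> int \<Rightarrow> rquat" where
  "lip a b c d = Quat (of_int a) (of_int b) (of_int c) (of_int d)"

definition half :: "int \<Rightarrow> int \<Rightarrow> int \<Rightarrow> int \<Rightarrow> rquat" where
  "half a b c d = Quat (of_int a / 2) (of_int b / 2) (of_int c / 2) (of_int d / 2)"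

definition mults :: "int \<Rightarrow> rquat set \<Rightarrow> rquat set" where
  "mults n R = (\<lambda>r. of_int n * r) ` R"

lemma multsI: "x = of_int n * y \<Longrightarrow> y \<in> R \<Longrightarrow> x \<in> mults n R"
  by (auto simp: mults_def)

lemma multsE:
  assumes "x \<in> mults n R"
  obtains y where "y \<in> R" "x = of_int n * y"
  using assms by (auto simp: mults_def)

lemma lip_inject [simp]: "lip a b c d = lip a' b' c' d' \<longleftrightarrow> a = a' \<and> b = b' \<and> c = c' \<and> d = d'"
  by (simp add: lip_def)

lemma lip_ring_simps:
  "lip a b c d + lip a' b' c' d' = lip (a + a') (b + b') (c + c') (d + d')"
  "lip a b c d - lip a' b' c' d' = lip (a - a') (b - b') (c - c') (d - d')"
  "lip a b c d * lip a' b' c' d' = lip (a * a' - b * b' - c * c' - d * d')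
    (a * b' + b * a' + c * d' - d * c') (a * c' - b * d' + c * a' + d * b')
    (a * d' + b * c' - c * b' + d * a')"
  "of_int n * lip a b c d = lip (n * a) (n * b) (n * c) (n * d)"
  "of_int n * half a b c d = half (n * a) (n * b) (n * c) (n * d)"
  "half a b c d - half a' b' c' d' = half (a - a') (b - b') (c - c') (d - d')"
  by (simp_all add: lip_def half_def quat_arith scalar_of_int scalar_def field_simps)

lemma lip_eq_half: "lip a b c d = half (2 * a) (2 * b) (2 * c) (2 * d)"
  by (simp add: lip_def half_def)

lemma lip_consts: "1 = lip 1 0 0 0" "qi = lip 0 1 0 0" "qj = lip 0 0 1 0" "qk = lip 0 0 0 1"
  by (simp_all add: lip_def quat_arith scalar_of_int scalar_def qi_def qj_def qk_def)

lemma of_int_eq_lip: "of_int n = lip n 0 0 0"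
  by (simp add: lip_def scalar_of_int scalar_def)

lemma q_lip [simp]: "q0 (lip a b c d) = of_int a" "q1 (lip a b c d) = of_int b"
  "q2 (lip a b c d) = of_int c" "q3 (lip a b c d) = of_int d"
  by (simp_all add: lip_def)

lemma qnorm_lip: "qnorm (lip a b c d) = of_int (a\<^sup>2 + b\<^sup>2 + c\<^sup>2 + d\<^sup>2)"
  by (simp add: lip_def qnorm_def)

lemma lip_in_lipschitz [simp]: "lip a b c d \<in> lipschitz"
  by (simp add: lip_def lipschitz_def)

lemma lipschitzE:
  assumes "x \<in> lipschitz"
  obtains a b c d where "x = lip a b c d"
  using assms by (cases x) (auto simp: lipschitz_def lip_def elim!: Ints_cases)

lemma of_int_half_in_Ints: "of_int a / 2 \<in> (\<int> :: rat set) \<longleftrightarrow> even a"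
proof
  assume "of_int a / 2 \<in> (\<int> :: rat set)"
  then obtain b where "of_int a / 2 = (of_int b :: rat)" by (auto elim: Ints_cases)
  then have "of_int a = (of_int (2 * b) :: rat)" by (simp add: field_simps)
  then show "even a" by (simp only: of_int_eq_iff) simp
qed auto

lemma half_in_lipschitz [simp]:
  "half a b c d \<in> lipschitz \<longleftrightarrow> even a \<and> even b \<and> even c \<and> even d"
  by (simp add: half_def lipschitz_def of_int_half_in_Ints)

lemma half_in_hurwitz [simp]:
  "half a b c d \<in> hurwitz \<longleftrightarrow> even (a - b) \<and> even (b - c) \<and> even (c - d)"
proof -
  have "of_int x / 2 - 1 / 2 \<in> (\<int> :: rat set) \<longleftrightarrow> odd x" for x
    using of_int_half_in_Ints[of "x - 1"] by (simp add: diff_divide_distrib)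
  then show ?thesis
    by (auto simp: half_def hurwitz_def of_int_half_in_Ints)
qed

lemma lipschitz_subset_hurwitz: "lipschitz \<subseteq> hurwitz"
  by (auto simp: lipschitz_def hurwitz_def)

lemma hurwitzE:
  assumes "x \<in> hurwitz"
  obtains a b c d where "x = half a b c d" "even (a - b)" "even (b - c)" "even (c - d)"
proof -
  have *: "\<exists>n. y = of_int n / 2" if "y \<in> \<int> \<or> y - 1 / 2 \<in> \<int>" for y :: rat
    using that
  proof
    assume "y \<in> \<int>"
    then obtain n where "y = of_int n" by (auto elim: Ints_cases)
    then show ?thesis by (intro exI[of _ "2 * n"]) simp
  next
    assume "y - 1 / 2 \<in> \<int>"
    then obtain n where "y - 1 / 2 = of_int n" by (auto elim: Ints_cases)
    then show ?thesis by (intro exI[of _ "2 * n + 1"]) (simp add: field_simps)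
  qed
  obtain a b c d where "q0 x = of_int a / 2" "q1 x = of_int b / 2"
      "q2 x = of_int c / 2" "q3 x = of_int d / 2"
    using assms *[of "q0 x"] *[of "q1 x"] *[of "q2 x"] *[of "q3 x"] by (auto simp: hurwitz_def)
  then have "x = half a b c d" by (cases x) (simp add: half_def)
  then show thesis using assms that[of a b c d] by simp
qed

text \<open>
  Differences of elements of a reduced set have real part 0, so they are Lipschitz in either ring.
\<close>

lemma pure_hurwitzE:
  assumes "x \<in> hurwitz" and "q0 x = 0"
  obtains b c d where "x = lip 0 b c d"
proof -
  obtain a b c d where x: "x = half a b c d" and par: "even (a - b)" "even (b - c)" "even (c - d)"
    using assms(1) by (rule hurwitzE)
  have "a = 0" using assms(2) x by (simp add: half_def)
  with par obtain b' c' d' where "b = 2 * b'" "c = 2 * c'" "d = 2 * d'"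
    by (auto elim!: evenE)
  with x \<open>a = 0\<close> show thesis by (intro that) (simp add: lip_eq_half)
qed

lemma lip_in_mults_lipschitz:
  "lip a b c d \<in> mults n lipschitz \<longleftrightarrow> n dvd a \<and> n dvd b \<and> n dvd c \<and> n dvd d"
proof
  assume "lip a b c d \<in> mults n lipschitz"
  then show "n dvd a \<and> n dvd b \<and> n dvd c \<and> n dvd d"
    by (auto simp: lip_ring_simps elim!: multsE lipschitzE)
next
  assume "n dvd a \<and> n dvd b \<and> n dvd c \<and> n dvd d"
  then obtain a' b' c' d' where "lip a b c d = of_int n * lip a' b' c' d'"
    by (auto simp: lip_ring_simps elim!: dvdE)
  then show "lip a b c d \<in> mults n lipschitz" by (rule multsI) simp
qed

lemma two_times_half: "2 * half a b c d = lip a b c d"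
  using lip_ring_simps(5)[of 2 a b c d] by (simp add: lip_eq_half)

lemma two_times_cancel: "2 * x = 2 * y \<Longrightarrow> x = (y :: rquat)"
  unfolding mult_2 by (cases x; cases y) (simp add: quat_arith)

lemma lip_in_mults_2_hurwitz:
  "lip a b c d \<in> mults 2 hurwitz \<longleftrightarrow> even (a - b) \<and> even (b - c) \<and> even (c - d)"
proof
  assume "lip a b c d \<in> mults 2 hurwitz"
  then obtain x where "x \<in> hurwitz" "lip a b c d = of_int 2 * x" by (rule multsE)
  moreover from \<open>x \<in> hurwitz\<close> obtain a' b' c' d' where "x = half a' b' c' d'"
      "even (a' - b')" "even (b' - c')" "even (c' - d')" by (rule hurwitzE)
  ultimately show "even (a - b) \<and> even (b - c) \<and> even (c - d)"
    by (simp add: two_times_half)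
next
  assume "even (a - b) \<and> even (b - c) \<and> even (c - d)"
  then have "half a b c d \<in> hurwitz" by simp
  moreover have "lip a b c d = of_int 2 * half a b c d"
    by (simp add: two_times_half)
  ultimately show "lip a b c d \<in> mults 2 hurwitz" by (auto intro: multsI)
qed

lemma is_subring_lipschitz: "is_subring lipschitz"
  by (auto simp: is_subring_def lip_consts lip_ring_simps elim!: lipschitzE)

lemma is_subring_hurwitz: "is_subring hurwitz"
proof -
  have "half a b c d * half a' b' c' d' \<in> hurwitz"
    if "even (a - b)" "even (b - c)" "even (c - d)" "even (a' - b')" "even (b' - c')" "even (c' - d')"
    for a b c d a' b' c' d'
  proof -
    have ex: "\<exists>k. x = y + 2 * k" if "even (x - y)" for x y :: int
      using that by (metis dvdE add_diff_cancel_left' add.commute diff_add_cancel)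
    have "even (b - a)" "even (c - a)" "even (d - a)" "even (b' - a')" "even (c' - a')" "even (d' - a')"
      using that by auto
    note par = this[THEN ex]
    obtain k l m where "b = a + 2 * k" "c = a + 2 * l" "d = a + 2 * m"
      using par by blast
    moreover obtain k' l' m' where "b' = a' + 2 * k'" "c' = a' + 2 * l'" "d' = a' + 2 * m'"
      using par by blast
    ultimately have "half a b c d * half a' b' c' d' = half
      (- a * a' - a * k' - a * l' - a * m' - k * a' - l * a' - m * a' - 2 * (k * k' + l * l' + m * m'))
      (a * a' + a * k' + k * a' + a * m' + l * a' + 2 * l * m' - a * l' - m * a' - 2 * m * l')
      (a * a' + a * l' + l * a' - a * m' - k * a' - 2 * k * m' + a * k' + m * a' + 2 * m * k')
      (a * a' + a * m' + m * a' + a * l' + k * a' + 2 * k * l' - a * k' - l * a' - 2 * l * k')"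
      by (simp add: half_def quat_arith field_simps)
    then show ?thesis by simp
  qed
  moreover have "1 \<in> hurwitz" by (simp add: lip_consts lip_eq_half)
  ultimately show ?thesis
    unfolding is_subring_def by (auto simp: lip_ring_simps elim!: hurwitzE)
qed

lemma mults_mult_right: "is_subring R \<Longrightarrow> x \<in> mults n R \<Longrightarrow> y \<in> R \<Longrightarrow> x * y \<in> mults n R"
  by (auto simp: mult.assoc is_subringD elim!: multsE intro!: multsI)

lemma mults_mult_left: "is_subring R \<Longrightarrow> x \<in> mults n R \<Longrightarrow> y \<in> R \<Longrightarrow> y * x \<in> mults n R"
proof -
  assume R: "is_subring R" and "x \<in> mults n R" and y: "y \<in> R"
  then obtain z where z: "z \<in> R" "x = of_int n * z" by (auto elim: multsE)
  have "y * x = of_int n * (y * z)"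
    using z(2) by (metis mult.assoc scalar_of_int scalar_commutes)
  then show ?thesis by (rule multsI) (use R y z(1) in \<open>auto simp: is_subringD\<close>)
qed

lemma mults_add: "is_subring R \<Longrightarrow> x \<in> mults n R \<Longrightarrow> y \<in> mults n R \<Longrightarrow> x + y \<in> mults n R"
  by (elim multsE) (auto simp: is_subringD intro!: multsI simp flip: distrib_left)

lemma mults_diff: "is_subring R \<Longrightarrow> x \<in> mults n R \<Longrightarrow> y \<in> mults n R \<Longrightarrow> x - y \<in> mults n R"
  by (elim multsE) (auto simp: is_subringD intro!: multsI simp flip: right_diff_distrib)

lemma reduced_same_trace_norm:
  assumes "reduced R S"
  obtains t s where "\<And>a. a \<in> S \<Longrightarrow> q0 a = t \<and> qnorm a = s"
proof -
  obtain m :: "int poly" where deg: "Polynomial.degree m = 2" and m: "S \<subseteq> minpoly_class R m"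
    using assms by (auto simp: reduced_def)
  have "q0 a = - of_int (Polynomial.coeff m 1) / 2 \<and> qnorm a = of_int (Polynomial.coeff m 0)"
    if "a \<in> S" for a
  proof -
    have eq: "qminpoly a = map_poly of_int m" using m that by (auto simp: minpoly_class_def)
    have "Polynomial.degree (qminpoly a) = 2"
      unfolding eq using deg by (simp add: degree_map_poly)
    then have qm: "qminpoly a = [:qnorm a, - 2 * q0 a, 1:]"
      by (auto simp: qminpoly_def split: if_splits)
    have "Polynomial.coeff (qminpoly a) n = of_int (Polynomial.coeff m n)" for n
      by (simp add: eq coeff_map_poly)
    from this[of 0] this[of 1] show ?thesis by (simp add: qm)
  qed
  then show thesis by (rule that)
qed

text \<open>
  The multiplier criterion for \<open>w / n\<close>, with the denominator moved to the other side.
\<close>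

lemma ringset_imp_mults:
  assumes "is_subring R" and "reduced R S" and "ringset R S" and n: "n \<noteq> 0"
    and w: "\<And>d. d \<in> Delta S \<Longrightarrow> w * d \<in> mults n R" and "r \<in> R" and "a \<in> S"
  shows "w * (r * a - a * r) \<in> mults n R"
proof -
  obtain t s where ts: "\<And>a. a \<in> S \<Longrightarrow> q0 a = t \<and> qnorm a = s"
    using assms(2) by (rule reduced_same_trace_norm) blast
  have sc: "scalar (of_int n) * scalar (1 / of_int n) = 1" "scalar (1 / of_int n) * scalar (of_int n) = 1"
    using n by (simp_all add: scalar_def quat_arith)
  have "(scalar (1 / of_int n) * w) * d \<in> R" if "d \<in> Delta S" for d
    using w[OF that]
    by (auto simp: scalar_of_int mult.assoc sc(2) elim!: multsE simp flip: mult.assoc[of _ "scalar (of_int n)"])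
  moreover have "S \<subseteq> R" using assms(2) by (simp add: reduced_def)
  ultimately have "(scalar (1 / of_int n) * w) * (r * a - a * r) \<in> R"
    using ringset_iff_multipliers[OF assms(1) _ ts] assms by blast
  moreover have "w * (r * a - a * r) = of_int n * ((scalar (1 / of_int n) * w) * (r * a - a * r))"
    by (simp add: scalar_of_int sc(1) flip: mult.assoc)
  ultimately show ?thesis by (auto intro: multsI)
qed

section \<open>Conjugation and the gcd of norms\<close>

definition qcnj :: "rquat \<Rightarrow> rquat" where
  "qcnj x = Quat (q0 x) (- q1 x) (- q2 x) (- q3 x)"

lemma qcnj_lip [simp]: "qcnj (lip a b c d) = lip a (- b) (- c) (- d)"
  by (simp add: qcnj_def lip_def)

lemma mult_qcnj: "x * qcnj x = scalar (qnorm x)"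
  by (simp add: qcnj_def scalar_def quat_arith qnorm_def power2_eq_square)

lemma Gamma_dvd_norm:
  assumes "d \<in> Delta S" and "qnorm d = of_int n"
  shows "int (Gamma S) dvd n"
proof -
  have "0 \<le> qnorm d" by (simp add: qnorm_def)
  with assms(2) have "n \<ge> 0" by simp
  then have "qnorm d = of_nat (nat n)" using assms(2) by simp
  then have "Gamma S dvd nat n"
    unfolding Gamma_def using assms(1) by (intro Gcd_dvd) blast
  with \<open>n \<ge> 0\<close> show ?thesis by (metis int_dvd_int_iff int_nat_eq)
qed

lemma dvd_GammaI:
  assumes "\<And>d n. d \<in> Delta S \<Longrightarrow> qnorm d = of_nat n \<Longrightarrow> m dvd n"
  shows "m dvd Gamma S"
  unfolding Gamma_def by (rule Gcd_greatest) (use assms in auto)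

text \<open>
  A Bezout argument for a possibly infinite set of numbers: a subgroup of the integers is generated
  by its least positive element.
\<close>

lemma Gcd_in_subgroup:
  fixes G :: "int set" and X :: "nat set"
  assumes "0 \<in> G" and diff: "\<And>x y. x \<in> G \<Longrightarrow> y \<in> G \<Longrightarrow> x - y \<in> G"
    and X: "\<And>n. n \<in> X \<Longrightarrow> int n \<in> G"
  shows "int (Gcd X) \<in> G"
proof -
  have neg: "- x \<in> G" if "x \<in> G" for x using diff[OF assms(1) that] by simp
  have add: "x + y \<in> G" if "x \<in> G" "y \<in> G" for x y
    using diff[OF that(1) neg[OF that(2)]] by simp
  have nmult: "int n * x \<in> G" if "x \<in> G" for n x
    by (induction n) (use that assms(1) add in \<open>auto simp: algebra_simps\<close>)
  have mult: "k * x \<in> G" if "x \<in> G" for k x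
    by (cases k) (use nmult[OF that] neg in \<open>auto simp del: of_nat_Suc\<close>)
  show ?thesis
  proof (cases "\<exists>n>0. int n \<in> G")
    case False
    then have "X \<subseteq> {0}" using X by (metis gr0I insertI1 subsetI)
    then have "Gcd X = 0" by simp
    then show ?thesis using assms(1) by (metis of_nat_0)
  next
    case True
    define g where "g = (LEAST n. n > 0 \<and> int n \<in> G)"
    have g: "g > 0" "int g \<in> G" and least: "\<And>n. n > 0 \<Longrightarrow> int n \<in> G \<Longrightarrow> g \<le> n"
      using LeastI_ex[OF True] Least_le[of "\<lambda>n. n > 0 \<and> int n \<in> G"] by (auto simp: g_def)
    have "g dvd n" if "n \<in> X" for n
    proof (rule ccontr)
      assume "\<not> g dvd n"
      then have "n mod g > 0" by (simp add: dvd_eq_mod_eq_0)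
      moreover have "int (n mod g) = int n - int (n div g) * int g"
        by (metis add_diff_cancel_left' mod_div_mult_eq of_nat_add of_nat_mult add.commute)
      then have "int (n mod g) \<in> G" using diff[OF X[OF that] mult[OF g(2)]] by metis
      ultimately have "g \<le> n mod g" by (rule least)
      then show False using g(1) by (meson mod_less_divisor not_le)
    qed
    then have "g dvd Gcd X" by (rule Gcd_greatest)
    then obtain k where "Gcd X = g * k" by (rule dvdE)
    then have "int (Gcd X) = int k * int g" by simp
    then show ?thesis using mult[OF g(2)] by metis
  qed
qed

text \<open>
  Turns the exclusion of odd primes and of a power of 2 into a finite list of possible values.
\<close>

lemma nat_cases_no_odd_prime:
  fixes n :: nat
  assumes "\<not> 2 ^ e dvd n" and "\<And>p. prime p \<Longrightarrow> odd p \<Longrightarrow> \<not> p dvd n"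
  shows "\<exists>k<e. n = 2 ^ k"
proof -
  have "n \<noteq> 0" using assms(1) by (metis dvd_0_right)
  then obtain m where n: "n = 2 ^ multiplicity 2 n * m" and m: "odd m"
    using multiplicity_decompose'[of n 2 thesis] by simp
  define k where "k = multiplicity 2 n"
  note n = n[folded k_def]
  have "m = 1"
  proof (rule ccontr)
    assume "m \<noteq> 1"
    then obtain p where p: "prime p" "p dvd m" using prime_factor_nat by blast
    with m have "odd p" by (meson dvd_trans)
    then show False using assms(2)[OF p(1)] p(2) n by simp
  qed
  moreover have "k < e"
    using assms(1) n by (meson dvd_triv_left dvd_trans le_imp_power_dvd not_less)
  ultimately show ?thesis using n by auto
qed

section \<open>Arithmetic modulo an odd prime\<close>

lemma odd_prime_not_dvd_two:
  fixes p :: int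
  assumes "prime p" "odd p"
  shows "\<not> p dvd 2"
  using assms prime_ge_2_int[of p] by (metis dual_order.antisym dvd_refl zdvd_imp_le zero_less_numeral)

text \<open>
  The three norms are those of twice the commutators of \<open>(x, y, z) / 2\<close> with \<open>k\<close>, \<open>j\<close>, \<open>i\<close>.
\<close>

lemma odd_prime_dvd_all:
  fixes p x y z :: int
  assumes p: "prime p" "odd p" and "p dvd 4 * (x\<^sup>2 + y\<^sup>2)" "p dvd 4 * (x\<^sup>2 + z\<^sup>2)" "p dvd 4 * (y\<^sup>2 + z\<^sup>2)"
  shows "p dvd x \<and> p dvd y \<and> p dvd z"
proof -
  have "\<not> p dvd 8" using prime_dvd_power[OF p(1), of 2 3] odd_prime_not_dvd_two[OF p] by auto
  then have sq: "p dvd u" if "p dvd 8 * u\<^sup>2" for u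
    using that p(1) by (simp add: prime_dvd_mult_iff prime_dvd_power_iff)
  have "8 * x\<^sup>2 = 4 * (x\<^sup>2 + y\<^sup>2) + 4 * (x\<^sup>2 + z\<^sup>2) - 4 * (y\<^sup>2 + z\<^sup>2)"
    "8 * y\<^sup>2 = 4 * (x\<^sup>2 + y\<^sup>2) + 4 * (y\<^sup>2 + z\<^sup>2) - 4 * (x\<^sup>2 + z\<^sup>2)"
    "8 * z\<^sup>2 = 4 * (x\<^sup>2 + z\<^sup>2) + 4 * (y\<^sup>2 + z\<^sup>2) - 4 * (x\<^sup>2 + y\<^sup>2)" by simp_all
  then show ?thesis using assms(3-5) sq by (metis dvd_add dvd_diff)
qed

text \<open>
  A nondegenerate symmetric bilinear form in three variables modulo \<open>p\<close> has no totally isotropic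
  plane, so orthogonal isotropic vectors are parallel. Explicitly, \<open>(b z - c y)\<^sup>2\<close> is the Gram determinant of the last two coordinates,
  and each entry of that Gram matrix is known modulo \<open>p\<close> from the first coordinates alone.
\<close>

lemma cross_component_dvd:
  fixes p :: int
  assumes p: "prime p" and "p dvd a\<^sup>2 + b\<^sup>2 + c\<^sup>2" "p dvd x\<^sup>2 + y\<^sup>2 + z\<^sup>2" "p dvd a * x + b * y + c * z"
  shows "p dvd b * z - c * y"
proof -
  let ?u = "a\<^sup>2 + b\<^sup>2 + c\<^sup>2" and ?v = "x\<^sup>2 + y\<^sup>2 + z\<^sup>2" and ?s = "a * x + b * y + c * z"
  have "(b * z - c * y)\<^sup>2 = ?u * (?v - x\<^sup>2) - a\<^sup>2 * ?v - ?s * (?s - 2 * a * x)"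
    by (simp add: power2_eq_square algebra_simps)
  then have "p dvd (b * z - c * y)\<^sup>2" using assms(2-4) by simp
  then show ?thesis using p by (simp add: prime_dvd_power_iff)
qed

text \<open>
  If \<open>w x\<close> vanishes modulo \<open>p\<close>, so does \<open>w N(x)\<close>, on multiplying by the conjugate of \<open>x\<close>.
\<close>

lemma left_zero_divisor_mod_prime:
  assumes p: "prime p" and x: "x \<in> lipschitz" "qnorm x = of_int n"
    and w: "w \<in> lipschitz" "w \<notin> mults p lipschitz" "w * x \<in> mults p lipschitz"
  shows "p dvd n"
proof -
  have "qcnj x \<in> lipschitz" using x(1) by (auto elim!: lipschitzE)
  then have "w * x * qcnj x \<in> mults p lipschitz"
    by (rule mults_mult_right[OF is_subring_lipschitz w(3)])
  moreover have "w * x * qcnj x = of_int n * w"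
    by (simp add: mult.assoc mult_qcnj x(2) scalar_of_int scalar_commutes)
  ultimately have "of_int n * w \<in> mults p lipschitz" by simp
  moreover obtain a b c d where "w = lip a b c d" using w(1) by (rule lipschitzE)
  ultimately show ?thesis
    using w(2) p by (auto simp: lip_ring_simps lip_in_mults_lipschitz prime_dvd_mult_iff)
qed

section \<open>Reduced sets\<close>

locale reduced_set =
  fixes R S :: "rquat set"
  assumes R_cases: "R = lipschitz \<or> R = hurwitz" and reduced: "reduced R S"
begin

lemma subring_R: "is_subring R"
  using R_cases is_subring_lipschitz is_subring_hurwitz by auto

lemma S_subset: "S \<subseteq> R"
  using reduced by (simp add: reduced_def)

lemma R_subset_hurwitz: "R \<subseteq> hurwitz"
  using R_cases lipschitz_subset_hurwitz by auto

lemma lipschitz_subset: "lipschitz \<subseteq> R"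
  using R_cases lipschitz_subset_hurwitz by auto

lemma lip_in_R [simp]: "lip a b c d \<in> R"
  using lipschitz_subset by auto

lemma not_subset_mults: "n \<ge> 2 \<Longrightarrow> (\<And>x. x \<in> S \<Longrightarrow> x + of_int a \<in> mults n R) \<Longrightarrow> False"
  using reduced unfolding reduced_def mults_def by blast

lemma S_nonempty: "S \<noteq> {}"
  using not_subset_mults[of 2] by auto

lemma S_halfE:
  assumes "x \<in> S"
  obtains a b c d where "x = half a b c d" "half a b c d \<in> R"
  using assms S_subset R_subset_hurwitz by (metis hurwitzE subset_iff)

lemma DeltaE:
  assumes "d \<in> Delta S"
  obtains u v w where "d = lip 0 u v w"
proof -
  obtain t s where "\<And>x. x \<in> S \<Longrightarrow> q0 x = t \<and> qnorm x = s"
    using reduced by (rule reduced_same_trace_norm) blast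
  then have "q0 d = 0" using assms by (auto simp: Delta_def minus_rquat_def)
  moreover have "d \<in> hurwitz"
    using assms S_subset R_subset_hurwitz is_subringD(4)[OF is_subring_hurwitz] unfolding Delta_def by blast
  ultimately show thesis using that by (metis pure_hurwitzE)
qed

lemma diff_in_Delta: "x \<in> S \<Longrightarrow> y \<in> S \<Longrightarrow> x - y \<in> Delta S"
  by (auto simp: Delta_def)

lemma Gamma_dvd: "lip 0 u v w \<in> Delta S \<Longrightarrow> int (Gamma S) dvd u\<^sup>2 + v\<^sup>2 + w\<^sup>2"
  using Gamma_dvd_norm[of "lip 0 u v w" S] qnorm_lip[of 0 u v w] by simp

section \<open>Odd prime divisors of the gcd of norms\<close>

text \<open>
  If all differences vanish modulo \<open>p\<close>, take \<open>w = 1\<close>. Otherwise \<open>w\<close> is the conjugate of a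
  difference \<open>y - x\<close> that does not: its product with another difference \<open>z - x\<close> consists of
  their inner product and their cross product. The inner product vanishes modulo \<open>p\<close> by
  polarization, \<open>z - y\<close> being a difference as well, and then so does the cross product.
\<close>

lemma odd_prime_annihilator:
  assumes p: "prime p" "odd p" and dvd: "p dvd int (Gamma S)"
  obtains w where "w \<in> lipschitz" "w \<notin> mults p lipschitz"
    "\<And>d. d \<in> Delta S \<Longrightarrow> w * d \<in> mults p lipschitz"
proof -
  obtain x where x: "x \<in> S" using S_nonempty by blast
  have norm: "p dvd u\<^sup>2 + v\<^sup>2 + w\<^sup>2" if "lip 0 u v w \<in> Delta S" for u v w
    using dvd Gamma_dvd[OF that] by (rule dvd_trans)
  obtain w where w: "w \<in> lipschitz" "w \<notin> mults p lipschitz"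
    and wS: "\<And>y. y \<in> S \<Longrightarrow> w * (y - x) \<in> mults p lipschitz"
  proof (cases "\<forall>y\<in>S. y - x \<in> mults p lipschitz")
    case True
    moreover have "1 \<in> lipschitz" "1 \<notin> mults p lipschitz"
      unfolding lip_consts(1) lip_in_mults_lipschitz using p by auto
    ultimately show ?thesis using that[of 1] by simp
  next
    case False
    then obtain y where y: "y \<in> S" "y - x \<notin> mults p lipschitz" by blast
    obtain a b c where yx: "y - x = lip 0 a b c" using DeltaE[OF diff_in_Delta[OF y(1) x]] .
    have "lip 0 (- a) (- b) (- c) * (z - x) \<in> mults p lipschitz" if z: "z \<in> S" for z
    proof -
      obtain u v w where zx: "z - x = lip 0 u v w" using DeltaE[OF diff_in_Delta[OF z x]] .
      have "z - y = (z - x) - (y - x)" by simp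
      then have "z - y = lip 0 (u - a) (v - b) (w - c)" by (simp add: zx yx lip_ring_simps)
      then have d: "p dvd a\<^sup>2 + b\<^sup>2 + c\<^sup>2" "p dvd u\<^sup>2 + v\<^sup>2 + w\<^sup>2"
          "p dvd (u - a)\<^sup>2 + (v - b)\<^sup>2 + (w - c)\<^sup>2"
        using norm diff_in_Delta z x y(1) yx zx by metis+
      \<comment> \<open>polarization; the factor 2 is invertible modulo \<open>p\<close>\<close>
      have "2 * (a * u + b * v + c * w) = (a\<^sup>2 + b\<^sup>2 + c\<^sup>2) + (u\<^sup>2 + v\<^sup>2 + w\<^sup>2)
          - ((u - a)\<^sup>2 + (v - b)\<^sup>2 + (w - c)\<^sup>2)"
        by (simp add: power2_eq_square algebra_simps)
      then have "p dvd 2 * (a * u + b * v + c * w)" using d by (metis dvd_add dvd_diff)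
      then have dot: "p dvd a * u + b * v + c * w"
        using p(1) odd_prime_not_dvd_two[OF p] by (metis prime_dvd_mult_iff)
      have "p dvd b * w - c * v" "p dvd c * u - a * w" "p dvd a * v - b * u"
        using cross_component_dvd[OF p(1), of a b c u v w] cross_component_dvd[OF p(1), of b c a v w u]
          cross_component_dvd[OF p(1), of c a b w u v] d dot by (simp_all add: ac_simps)
      then have "p dvd c * v - b * w" "p dvd a * w - c * u" "p dvd b * u - a * v"
        by (simp_all add: dvd_diff_commute)
      then show ?thesis
        using dot by (simp add: zx lip_ring_simps lip_in_mults_lipschitz)
    qed
    moreover have "lip 0 (- a) (- b) (- c) \<notin> mults p lipschitz"
      using y(2) by (simp add: yx lip_in_mults_lipschitz)
    ultimately show ?thesis using that lip_in_lipschitz by blast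
  qed
  have "w * d \<in> mults p lipschitz" if d: "d \<in> Delta S" for d
  proof -
    obtain y z where yz: "y \<in> S" "z \<in> S" "d = y - z" using d unfolding Delta_def by blast
    have "w * d = w * (y - x) - w * (z - x)" unfolding yz(3) by (simp add: algebra_simps)
    with wS yz show ?thesis by (simp add: mults_diff is_subring_lipschitz)
  qed
  with w show thesis by (rule that)
qed

text \<open>
  Applied to the annihilator \<open>w\<close>, the ringset property makes \<open>w (r a - a r)\<close> vanish modulo \<open>p\<close>,
  so that \<open>p\<close> divides the norms of the commutators and therefore every imaginary coordinate of
  \<open>a\<close>. As all real parts agree, an integer translation moves \<open>S\<close> into \<open>p R\<close>.
\<close>

lemma odd_prime_not_dvd_Gamma:
  assumes ring: "ringset R S" and p: "prime p" "odd p"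
  shows "\<not> p dvd int (Gamma S)"
proof
  assume "p dvd int (Gamma S)"
  with p obtain w where w: "w \<in> lipschitz" "w \<notin> mults p lipschitz"
    and wD: "\<And>d. d \<in> Delta S \<Longrightarrow> w * d \<in> mults p lipschitz"
    by (rule odd_prime_annihilator) (rule that)
  have p0: "p \<noteq> 0" "p \<ge> 2" using p(1) by (auto simp: prime_ge_2_int)
  have twice: "2 * y \<in> lipschitz" if "y \<in> R" for y
    using that R_subset_hurwitz by (auto simp: two_times_half elim!: hurwitzE)
  have norm: "p dvd n" if "r \<in> R" "x \<in> S" "qnorm (2 * (r * x - x * r)) = of_int n" for r x n
  proof (rule left_zero_divisor_mod_prime[OF p(1) _ that(3) w])
    show "2 * (r * x - x * r) \<in> lipschitz"
      using that S_subset by (intro twice is_subringD[OF subring_R]) auto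
    have "w * (r * x - x * r) \<in> mults p R"
      using wD lipschitz_subset by (intro ringset_imp_mults[OF subring_R reduced ring p0(1) _ that(1,2)]) (auto simp: mults_def)
    then obtain y where y: "y \<in> R" "w * (r * x - x * r) = of_int p * y" by (rule multsE)
    have "2 * (w * (r * x - x * r)) = of_int p * (2 * y)"
      unfolding y(2) by (simp only: mult_2 distrib_left)
    moreover have "w * (2 * (r * x - x * r)) = 2 * (w * (r * x - x * r))"
      by (simp only: mult_2 distrib_left)
    ultimately have "w * (2 * (r * x - x * r)) = of_int p * (2 * y)" by (simp only:)
    then show "w * (2 * (r * x - x * r)) \<in> mults p lipschitz"
      by (rule multsI) (rule twice[OF y(1)])
  qed
  have imag: "p dvd b \<and> p dvd c \<and> p dvd d" if "half a b c d \<in> S" for a b c d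
  proof (rule odd_prime_dvd_all[OF p])
    let ?x = "half a b c d"
    have "2 * (qi * ?x - ?x * qi) = lip 0 0 (- 2 * d) (2 * c)"
      "2 * (qj * ?x - ?x * qj) = lip 0 (2 * d) 0 (- 2 * b)"
      "2 * (qk * ?x - ?x * qk) = lip 0 (- 2 * c) (2 * b) 0"
      unfolding mult_2 by (simp_all add: lip_def half_def qi_def qj_def qk_def quat_arith)
    then show "p dvd 4 * (b\<^sup>2 + c\<^sup>2)" "p dvd 4 * (b\<^sup>2 + d\<^sup>2)" "p dvd 4 * (c\<^sup>2 + d\<^sup>2)"
      using norm[of qi ?x "4 * (c\<^sup>2 + d\<^sup>2)"] norm[of qj ?x "4 * (b\<^sup>2 + d\<^sup>2)"]
        norm[of qk ?x "4 * (b\<^sup>2 + c\<^sup>2)"] that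
      by (simp_all add: qnorm_lip lip_consts power_mult_distrib algebra_simps)
  qed
  obtain t s where ts: "\<And>x. x \<in> S \<Longrightarrow> q0 x = t \<and> qnorm x = s"
    using reduced by (rule reduced_same_trace_norm) blast
  obtain x0 where "x0 \<in> S" using S_nonempty by blast
  then obtain a0 where a0: "t = of_int a0 / 2" using ts by (metis S_halfE half_def rquat.sel(1))
  obtain h where h: "p = 2 * h + 1" using p(2) by (rule oddE)
  \<comment> \<open>The common real part is \<open>a0 / 2\<close>, and \<open>a0 / 2 + a0 h = p a0 / 2\<close>; multiplication by the odd \<open>p\<close>
    preserves parities, so the quotient by \<open>p\<close> stays in \<open>R\<close>.\<close>
  have "x + of_int (a0 * h) \<in> mults p R" if x: "x \<in> S" for x
  proof -
    obtain a b c d where xh: "x = half a b c d" "half a b c d \<in> R" using x by (rule S_halfE)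
    have "a = a0" using ts[OF x] a0 xh(1) by (simp add: half_def)
    obtain b' c' d' where bcd: "b = p * b'" "c = p * c'" "d = p * d'"
      using imag x xh(1) by (metis dvdE)
    have "half a b' c' d' \<in> R"
      using xh(2) R_cases p(2) by (auto simp: bcd)
    moreover have "x + of_int (a0 * h) = of_int p * half a b' c' d'"
      unfolding xh of_int_eq_lip lip_eq_half bcd
      by (simp add: \<open>a = a0\<close> half_def quat_arith h field_simps)
    ultimately show ?thesis by (auto intro: multsI)
  qed
  with p0(2) show False by (rule not_subset_mults)
qed

end

section \<open>Divisibility by powers of two\<close>

lemma square_mod_4: "(x::int)\<^sup>2 mod 4 = (if even x then 0 else 1)"
proof (cases "even x")
  case True
  then obtain k where "x = 2 * k" by (rule evenE)
  then show ?thesis by (simp add: power_mult_distrib)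
next
  case False
  then obtain k where "x = 2 * k + 1" by (rule oddE)
  then have "x\<^sup>2 = 4 * (k\<^sup>2 + k) + 1" by (simp add: power2_eq_square algebra_simps)
  then show ?thesis using False by presburger
qed

lemma four_dvd_sum_three_squares:
  fixes x y z :: int
  assumes "4 dvd x\<^sup>2 + y\<^sup>2 + z\<^sup>2"
  shows "even x \<and> even y \<and> even z"
  using assms square_mod_4[of x] square_mod_4[of y] square_mod_4[of z]
  by (simp split: if_splits) presburger+

context reduced_set
begin

lemma four_dvd_imp_Delta_even:
  assumes "4 dvd int (Gamma S)" and "d \<in> Delta S"
  obtains u v w where "d = lip 0 (2 * u) (2 * v) (2 * w)"
proof -
  obtain u v w where d: "d = lip 0 u v w" using assms(2) by (rule DeltaE)
  have "4 dvd u\<^sup>2 + v\<^sup>2 + w\<^sup>2"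
    using assms(1) Gamma_dvd[OF assms(2)[unfolded d]] by (rule dvd_trans)
  then have "even u" "even v" "even w" using four_dvd_sum_three_squares by auto
  then show thesis using that d by (auto elim!: evenE)
qed

lemma eight_dvd_imp_Delta:
  assumes "8 dvd int (Gamma S)" and "d \<in> Delta S"
  obtains u v w where "d = lip 0 (2 * u) (2 * v) (2 * w)" "even (u + v + w)"
proof -
  have "4 dvd int (Gamma S)" using assms(1) by presburger
  then obtain u v w where d: "d = lip 0 (2 * u) (2 * v) (2 * w)"
    using assms(2) by (rule four_dvd_imp_Delta_even)
  have "8 dvd (2 * u)\<^sup>2 + (2 * v)\<^sup>2 + (2 * w)\<^sup>2"
    using assms(1) Gamma_dvd[OF assms(2)[unfolded d]] by (rule dvd_trans)
  then have "4 * 2 dvd 4 * (u\<^sup>2 + v\<^sup>2 + w\<^sup>2)" by (simp add: power_mult_distrib)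
  then have "even (u\<^sup>2 + v\<^sup>2 + w\<^sup>2)" by (simp only: dvd_times_left_cancel_iff)
  then show thesis using that d by auto
qed

text \<open>
  For each difference \<open>d\<close> the product \<open>N(d) w\<close> equals \<open>w d\<close> times the conjugate of \<open>d\<close>, and the
  integers \<open>n\<close> with \<open>n w \<in> R\<close> form a group.
\<close>

lemma Gamma_right_mult:
  assumes "\<And>d. d \<in> Delta S \<Longrightarrow> w * d \<in> R"
  shows "of_nat (Gamma S) * w \<in> R"
proof -
  let ?G = "{n::int. of_int n * w \<in> R}"
  have "int (Gamma S) \<in> ?G"
    unfolding Gamma_def
  proof (rule Gcd_in_subgroup)
    show "0 \<in> ?G" using is_subringD[OF subring_R] by simp
    show "x - y \<in> ?G" if "x \<in> ?G" "y \<in> ?G" for x y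
      using that is_subringD[OF subring_R] by (simp add: left_diff_distrib)
    fix n assume "n \<in> {n::nat. \<exists>d\<in>Delta S. qnorm d = of_nat n}"
    then obtain d where d: "d \<in> Delta S" "qnorm d = of_nat n" by blast
    have "qcnj d \<in> R" using d(1) by (metis DeltaE qcnj_lip lip_in_R)
    then have "w * d * qcnj d \<in> R" using assms[OF d(1)] is_subringD[OF subring_R] by simp
    moreover have "w * d * qcnj d = of_int (int n) * w"
      by (simp add: mult.assoc mult_qcnj d(2) scalar_of_nat scalar_commutes)
    ultimately show "int n \<in> ?G" by simp
  qed
  then show ?thesis by simp
qed

lemma ringset_if_multipliers:
  assumes "\<And>w r x. (\<And>d. d \<in> Delta S \<Longrightarrow> w * d \<in> R) \<Longrightarrow> r \<in> R \<Longrightarrow> x \<in> S \<Longrightarrow>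
    w * (r * x - x * r) \<in> R"
  shows "ringset R S"
proof -
  obtain t s where "\<And>x. x \<in> S \<Longrightarrow> q0 x = t \<and> qnorm x = s"
    using reduced by (rule reduced_same_trace_norm) blast
  then show ?thesis using ringset_iff_multipliers[OF subring_R S_subset] assms by blast
qed

end

section \<open>The Hurwitz ring\<close>

text \<open>
  Elements of even norm form the ideal generated by \<open>1 + i\<close>, whose square is \<open>2 H\<close>. The parity of
  the sum of the coordinates is the parity of the norm.
\<close>

lemma pure_even_product:
  assumes "even (u + v + w)" "even (x + y + z)"
  shows "lip 0 u v w * lip 0 x y z \<in> mults 2 hurwitz"
  unfolding lip_ring_simps lip_in_mults_2_hurwitz using assms by auto

text \<open>
  The quotient of the Hurwitz ring by the ideal of elements of even norm is the field with four
  elements, which is commutative. In coordinates, the commutator is half the cross product of the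
  doubled imaginary parts, and it becomes visibly even when these are written as a constant vector
  plus twice another vector.
\<close>

lemma commutator_even:
  assumes "r \<in> hurwitz" "x \<in> hurwitz"
  obtains b c d where "r * x - x * r = lip 0 b c d" "even (b + c + d)"
proof -
  have ex: "\<exists>k. x = y + 2 * k" if "even (y - x)" for x y :: int
    using that by presburger
  have rep: "\<exists>a k l m. x = half a (a + 2 * k) (a + 2 * l) (a + 2 * m)" if x: "x \<in> hurwitz" for x
  proof -
    obtain a b c d where x: "x = half a b c d" "even (a - b)" "even (b - c)" "even (c - d)"
      using x by (rule hurwitzE)
    then have "even (a - b)" "even (a - c)" "even (a - d)" by auto
    from this[THEN ex] show ?thesis using x(1) by blast
  qed
  obtain a k l m where r: "r = half a (a + 2 * k) (a + 2 * l) (a + 2 * m)"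
    using rep[OF assms(1)] by blast
  obtain a' k' l' m' where x: "x = half a' (a' + 2 * k') (a' + 2 * l') (a' + 2 * m')"
    using rep[OF assms(2)] by blast
  have "r * x - x * r = lip 0
      (a * m' + a' * l + 2 * l * m' - a * l' - a' * m - 2 * m * l')
      (a * k' + a' * m + 2 * m * k' - a * m' - a' * k - 2 * k * m')
      (a * l' + a' * k + 2 * k * l' - a * k' - a' * l - 2 * l * k')"
    by (simp add: r x half_def lip_def quat_arith field_simps)
  then show thesis by (rule that) simp
qed

locale reduced_hurwitz = reduced_set hurwitz S for S
begin

text \<open>
  Here \<open>1/2\<close> is a multiplier. The commutator with \<open>i\<close> then rules out half-integral elements of \<open>S\<close>,
  and the commutator with \<open>(1 + i + j + k) / 2\<close> makes the three imaginary coordinates congruent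
  modulo 2. Adjusting the parity of the real part puts an element into \<open>2 H\<close>, and the others
  follow because they differ from it by elements of \<open>2 H\<close>.
\<close>

lemma four_not_dvd_Gamma:
  assumes ring: "ringset hurwitz S"
  shows "\<not> 4 dvd int (Gamma S)"
proof
  assume four: "4 dvd int (Gamma S)"
  have D: "d \<in> mults 2 hurwitz" if "d \<in> Delta S" for d
    using four_dvd_imp_Delta_even[OF four that] lip_in_mults_2_hurwitz
    by (metis diff_0 dvd_minus_iff dvd_triv_left right_diff_distrib)
  obtain x where x: "x \<in> S" using S_nonempty by blast
  have comm: "r * x - x * r \<in> mults 2 hurwitz" if "r \<in> hurwitz" for r
    using ringset_imp_mults[OF subring_R reduced ring _ _ that x, of 2 1] D by simp
  obtain a b c d where xh: "x = half a b c d" "half a b c d \<in> hurwitz"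
    using x by (rule S_halfE)
  have "qi * x - x * qi = lip 0 0 (- d) c"
    by (simp add: xh(1) half_def lip_def qi_def quat_arith)
  then have "even d" using comm[of qi] by (simp add: lip_consts lip_in_mults_2_hurwitz)
  then have "even a" "even b" "even c" using xh(2) by auto
  with \<open>even d\<close> obtain a' b' c' d' where *: "a = 2 * a'" "b = 2 * b'" "c = 2 * c'" "d = 2 * d'"
    by (auto elim!: evenE)
  have xl: "x = lip a' b' c' d'" by (simp add: xh(1) * lip_eq_half)
  have "half 1 1 1 1 * x - x * half 1 1 1 1 = lip 0 (d' - c') (b' - d') (c' - b')"
    by (simp add: xl half_def lip_def quat_arith field_simps)
  then have bcd: "even (b' - c')" "even (c' - d')"
    using comm[of "half 1 1 1 1"] by (auto simp: lip_in_mults_2_hurwitz)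
  have x2: "x + of_int (b' - a') \<in> mults 2 hurwitz"
    unfolding xl of_int_eq_lip lip_ring_simps lip_in_mults_2_hurwitz using bcd by simp
  have "y + of_int (b' - a') \<in> mults 2 hurwitz" if "y \<in> S" for y
  proof -
    have "(y - x) + (x + of_int (b' - a')) \<in> mults 2 hurwitz"
      by (rule mults_add[OF subring_R D[OF diff_in_Delta[OF that x]] x2])
    then show ?thesis by simp
  qed
  then show False using not_subset_mults[of 2 "b' - a'"] by auto
qed

text \<open>
  For \<open>\<Gamma>(S) = 2\<close> some difference \<open>d\<close> has norm \<open>n = 2 (2 h + 1)\<close>. Computing \<open>w n (r x - x r)\<close> through
  \<open>w d\<close> and the conjugate of \<open>d\<close> shows that \<open>(2 h + 1) w (r x - x r)\<close> lies in \<open>H\<close>, while \<open>2 w\<close> lies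
  in \<open>H\<close> anyway.
\<close>

lemma ringset_if_Gamma:
  assumes "Gamma S = 1 \<or> Gamma S = 2"
  shows "ringset hurwitz S"
proof (rule ringset_if_multipliers)
  fix w r x
  assume w: "\<And>d. d \<in> Delta S \<Longrightarrow> w * d \<in> hurwitz" and r: "r \<in> hurwitz" and "x \<in> S"
  then have x: "x \<in> hurwitz" using S_subset by blast
  note ring = is_subringD[OF subring_R]
  have Gw: "of_nat (Gamma S) * w \<in> hurwitz" using w by (rule Gamma_right_mult)
  show "w * (r * x - x * r) \<in> hurwitz"
  proof (cases "Gamma S = 1")
    case True
    then show ?thesis using Gw ring r x by simp
  next
    case False
    then have G2: "Gamma S = 2" using assms by simp
    then have w2: "2 * w \<in> hurwitz" using Gw by simp
    have "\<not> 4 dvd Gamma S" using G2 by simp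
    then obtain d n where d: "d \<in> Delta S" "qnorm d = of_nat n" "\<not> 4 dvd n"
      using dvd_GammaI by blast
    have "even n" using Gamma_dvd_norm[OF d(1), of "int n"] d(2) G2 by simp
    with d(3) have "\<exists>h. n = 2 * (2 * h + 1)" by presburger
    then obtain h where n: "n = 2 * (2 * h + 1)" by blast
    obtain b c e where de: "d = lip 0 b c e" using d(1) by (rule DeltaE)
    have "rat_of_int (b\<^sup>2 + c\<^sup>2 + e\<^sup>2) = rat_of_int (int n)"
      using d(2) qnorm_lip[of 0 b c e] de by simp
    then have "b\<^sup>2 + c\<^sup>2 + e\<^sup>2 = int n" by (simp only: of_int_eq_iff)
    then have "even (b\<^sup>2 + c\<^sup>2 + e\<^sup>2)" using \<open>even n\<close> by simp
    then have par: "even (- b + - c + - e)" by auto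
    obtain b' c' e' where k: "r * x - x * r = lip 0 b' c' e'" "even (b' + c' + e')"
      using r x by (rule commutator_even)
    let ?k = "r * x - x * r"
    have "qcnj d * ?k \<in> mults 2 hurwitz"
      unfolding de k(1) qcnj_lip minus_zero using pure_even_product[OF par k(2)] by simp
    then obtain z where z: "z \<in> hurwitz" "qcnj d * ?k = 2 * z" by (auto elim: multsE)
    have "2 * (of_nat (2 * h + 1) * (w * ?k)) = of_nat n * (w * ?k)"
      by (simp only: n of_nat_mult of_nat_numeral mult.assoc)
    also have "\<dots> = w * (of_nat n * ?k)"
      by (metis mult.assoc scalar_of_nat scalar_commutes)
    also have "\<dots> = (w * d) * (qcnj d * ?k)"
      by (metis mult.assoc mult_qcnj d(2) scalar_of_nat)
    also have "\<dots> = 2 * ((w * d) * z)"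
      by (simp only: z(2) mult_2 distrib_left)
    finally have "of_nat (2 * h + 1) * (w * ?k) = (w * d) * z"
      by (rule two_times_cancel)
    moreover have "of_nat (2 * h + 1) * (w * ?k) = of_nat h * (2 * w * ?k) + w * ?k"
      by (simp add: mult_2 distrib_left distrib_right)
    ultimately have "w * ?k = (w * d) * z - of_nat h * (2 * w * ?k)" by (simp add: algebra_simps)
    moreover have "(of_nat h :: rquat) \<in> hurwitz"
      using of_int_eq_lip[of "int h"] lip_in_R[of "int h" 0 0 0] by simp
    ultimately show ?thesis
      using ring w[OF d(1)] z(1) w2 r x by metis
  qed
qed

lemma ringset_iff: "ringset hurwitz S \<longleftrightarrow> Gamma S = 1 \<or> Gamma S = 2"
proof
  assume ring: "ringset hurwitz S"
  have "\<not> 2 ^ 2 dvd Gamma S"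
    using four_not_dvd_Gamma[OF ring] int_dvd_int_iff[of 4 "Gamma S"] by simp
  moreover have "\<not> p dvd Gamma S" if "prime p" "odd p" for p
    using odd_prime_not_dvd_Gamma[OF ring, of "int p"] that int_dvd_int_iff[of p "Gamma S"] by simp
  ultimately obtain k where k: "k < 2" "Gamma S = 2 ^ k"
    using nat_cases_no_odd_prime by blast
  then show "Gamma S = 1 \<or> Gamma S = 2" by (auto simp: less_2_cases_iff)
qed (rule ringset_if_Gamma)

end

section \<open>The Lipschitz ring\<close>

locale reduced_lipschitz = reduced_set lipschitz S for S
begin

lemma S_lipE:
  assumes "x \<in> S"
  obtains a b c e where "x = lip a b c e"
  using assms S_subset by (metis lipschitzE subsetD)

lemma norm_eq:
  assumes "lip a b c e \<in> S" and "lip a' b' c' e' \<in> S"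
  shows "a' = a" and "b\<^sup>2 + c\<^sup>2 + e\<^sup>2 = b'\<^sup>2 + c'\<^sup>2 + e'\<^sup>2"
proof -
  obtain t s where ts: "\<And>x. x \<in> S \<Longrightarrow> q0 x = t \<and> qnorm x = s"
    using reduced by (rule reduced_same_trace_norm) blast
  show a: "a' = a" using ts[OF assms(1)] ts[OF assms(2)] by simp
  have "rat_of_int (a\<^sup>2 + b\<^sup>2 + c\<^sup>2 + e\<^sup>2) = rat_of_int (a'\<^sup>2 + b'\<^sup>2 + c'\<^sup>2 + e'\<^sup>2)"
    unfolding qnorm_lip[symmetric] using ts assms by simp
  then have "a\<^sup>2 + b\<^sup>2 + c\<^sup>2 + e\<^sup>2 = a'\<^sup>2 + b'\<^sup>2 + c'\<^sup>2 + e'\<^sup>2" by (simp only: of_int_eq_iff)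
  then show "b\<^sup>2 + c\<^sup>2 + e\<^sup>2 = b'\<^sup>2 + c'\<^sup>2 + e'\<^sup>2" using a by simp
qed

text \<open>
  The multiplier \<open>w / 4\<close> is incompatible with the ringset property: for each of these \<open>w\<close> the
  commutators with \<open>i\<close>, \<open>j\<close>, \<open>k\<close> can only be divisible by 4 after multiplication by \<open>w\<close> if all
  imaginary coordinates are even.
\<close>

lemma multiplier_contradiction:
  assumes ring: "ringset lipschitz S"
    and w: "w \<in> {lip 1 0 0 0, lip 0 1 1 0, lip 0 1 0 1, lip 0 0 1 1}"
    and wD: "\<And>d. d \<in> Delta S \<Longrightarrow> w * d \<in> mults 4 lipschitz"
  shows False
proof -
  have imag: "even b \<and> even c \<and> even d" if "lip a b c d \<in> S" for a b c d
  proof -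
    let ?x = "lip a b c d"
    have "w * (lip a' b' c' d' * ?x - ?x * lip a' b' c' d') \<in> mults 4 lipschitz" for a' b' c' d'
      by (rule ringset_imp_mults[OF subring_R reduced ring _ wD _ that]) simp_all
    from w this[of 0 1 0 0] this[of 0 0 1 0] this[of 0 0 0 1]
    show ?thesis
      by (simp only: insert_iff empty_iff simp_thms, elim disjE;
          simp add: lip_ring_simps lip_in_mults_lipschitz; presburger)
  qed
  obtain t s where ts: "\<And>x. x \<in> S \<Longrightarrow> q0 x = t \<and> qnorm x = s"
    using reduced by (rule reduced_same_trace_norm) blast
  obtain x0 where "x0 \<in> S" using S_nonempty by blast
  then obtain a0 where a0: "t = of_int a0" using ts S_subset by (metis lipschitzE q_lip(1) subsetD)
  have "x + of_int (- a0) \<in> mults 2 lipschitz" if x: "x \<in> S" for x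
  proof -
    obtain a b c d where xl: "x = lip a b c d" using x by (rule S_lipE)
    then have "a = a0" using ts[OF x] a0 by simp
    then show ?thesis
      using imag x unfolding xl of_int_eq_lip lip_ring_simps lip_in_mults_lipschitz by simp
  qed
  then show False using not_subset_mults[of 2 "- a0"] by blast
qed

lemma sixteen_not_dvd_Gamma:
  assumes ring: "ringset lipschitz S"
  shows "\<not> 16 dvd int (Gamma S)"
proof
  assume dvd: "16 dvd int (Gamma S)"
  then have four: "4 dvd int (Gamma S)" by presburger
  have "lip 1 0 0 0 * d \<in> mults 4 lipschitz" if d: "d \<in> Delta S" for d
  proof -
    obtain u v w where dl: "d = lip 0 (2 * u) (2 * v) (2 * w)"
      using four d by (rule four_dvd_imp_Delta_even)
    have "16 dvd (2 * u)\<^sup>2 + (2 * v)\<^sup>2 + (2 * w)\<^sup>2"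
      using dvd Gamma_dvd[OF d[unfolded dl]] by (rule dvd_trans)
    then have "4 * 4 dvd 4 * (u\<^sup>2 + v\<^sup>2 + w\<^sup>2)" by (simp add: power_mult_distrib)
    then have "4 dvd u\<^sup>2 + v\<^sup>2 + w\<^sup>2" by (simp only: dvd_times_left_cancel_iff)
    then have "even u" "even v" "even w" using four_dvd_sum_three_squares by auto
    then show ?thesis
      unfolding dl lip_ring_simps lip_in_mults_lipschitz by auto
  qed
  then show False using multiplier_contradiction[OF ring, of "lip 1 0 0 0"] by simp
qed

text \<open>
  For elements of equal norm, the norm of the difference is twice the norm minus twice the inner
  product.
\<close>

lemma two_dvd_Gamma: "2 dvd Gamma S"
proof (rule dvd_GammaI)
  fix d n assume d: "d \<in> Delta S" "qnorm d = of_nat n"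
  obtain x y where xy: "x \<in> S" "y \<in> S" "d = x - y" using d(1) unfolding Delta_def by blast
  obtain a b c e where x: "x = lip a b c e" using xy(1) by (rule S_lipE)
  obtain a' b' c' e' where y: "y = lip a' b' c' e'" using xy(2) by (rule S_lipE)
  have a: "a' = a" and eq: "b\<^sup>2 + c\<^sup>2 + e\<^sup>2 = b'\<^sup>2 + c'\<^sup>2 + e'\<^sup>2"
    using norm_eq[OF xy(1)[unfolded x] xy(2)[unfolded y]] by simp_all
  have "rat_of_int ((a - a')\<^sup>2 + (b - b')\<^sup>2 + (c - c')\<^sup>2 + (e - e')\<^sup>2) = rat_of_int (int n)"
    using d(2) unfolding xy(3) x y lip_ring_simps qnorm_lip by simp
  then have "int n = (b - b')\<^sup>2 + (c - c')\<^sup>2 + (e - e')\<^sup>2"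
    unfolding of_int_eq_iff by (simp add: a)
  also have "\<dots> = 2 * (b\<^sup>2 + c\<^sup>2 + e\<^sup>2 - b * b' - c * c' - e * e')"
    using eq by (simp add: power2_eq_square algebra_simps)
  finally show "2 dvd n" by presburger
qed

lemma cong_iff: "cong_mod4_lipschitz x y \<longleftrightarrow> x - y \<in> mults 4 lipschitz"
  by (simp add: cong_mod4_lipschitz_def mults_def)

lemma residues: "2 * qi + 2 * qj = lip 0 2 2 0" "2 * qi + 2 * qk = lip 0 2 0 2" "2 * qj + 2 * qk = lip 0 0 2 2"
  unfolding mult_2 by (simp_all add: lip_consts lip_ring_simps)

text \<open>
  Differences are 0 or one of the three residues modulo 4. If only one residue \<open>r\<close> occurs, then
  \<open>w = r / 2\<close> sends every difference into \<open>4 L\<close>, because \<open>w r = - 2 N(w) = - 4\<close>.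
\<close>

lemma condition_if_eight_dvd:
  assumes ring: "ringset lipschitz S" and dvd: "8 dvd int (Gamma S)"
  shows "\<exists>d1\<in>Delta S. \<exists>d2\<in>Delta S. \<exists>r1\<in>{lip 0 2 2 0, lip 0 2 0 2, lip 0 0 2 2}.
    \<exists>r2\<in>{lip 0 2 2 0, lip 0 2 0 2, lip 0 0 2 2}.
      r1 \<noteq> r2 \<and> cong_mod4_lipschitz d1 r1 \<and> cong_mod4_lipschitz d2 r2" (is ?thesis)
proof (rule ccontr)
  assume neg: "\<not> ?thesis"
  let ?X = "{lip 0 2 2 0, lip 0 2 0 2, lip 0 0 2 2}"
  have cases: "d \<in> mults 4 lipschitz \<or> (\<exists>r\<in>?X. cong_mod4_lipschitz d r)" if d: "d \<in> Delta S" for d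
  proof -
    obtain u v w where "d = lip 0 (2 * u) (2 * v) (2 * w)" "even (u + v + w)"
      using dvd d by (rule eight_dvd_imp_Delta)
    then show ?thesis
      by (simp add: cong_iff lip_ring_simps lip_in_mults_lipschitz) presburger
  qed
  have uniq: "r = r'" if "d \<in> Delta S" "d' \<in> Delta S" "r \<in> ?X" "r' \<in> ?X"
      "cong_mod4_lipschitz d r" "cong_mod4_lipschitz d' r'" for d d' r r'
    using neg that by blast
  obtain r where r: "r \<in> ?X"
    "\<And>d. d \<in> Delta S \<Longrightarrow> d \<in> mults 4 lipschitz \<or> cong_mod4_lipschitz d r"
  proof (cases "\<forall>d\<in>Delta S. d \<in> mults 4 lipschitz")
    case True
    then show ?thesis using that[of "lip 0 2 2 0"] by blast
  next
    case False
    then obtain d1 where d1: "d1 \<in> Delta S" "d1 \<notin> mults 4 lipschitz" by blast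
    then obtain r where r: "r \<in> ?X" "cong_mod4_lipschitz d1 r" using cases by blast
    show ?thesis
    proof (rule that[OF r(1)])
      fix d assume d: "d \<in> Delta S"
      show "d \<in> mults 4 lipschitz \<or> cong_mod4_lipschitz d r"
        using cases[OF d] uniq[OF d1(1) d r(1) _ r(2)] by blast
    qed
  qed
  have "\<exists>w\<in>{lip 0 1 1 0, lip 0 1 0 1, lip 0 0 1 1}. w * r \<in> mults 4 lipschitz"
    using r(1) by (auto simp: lip_ring_simps lip_in_mults_lipschitz)
  then obtain w where w: "w \<in> {lip 0 1 1 0, lip 0 1 0 1, lip 0 0 1 1}" "w * r \<in> mults 4 lipschitz"
    by blast
  then have "w \<in> lipschitz" by auto
  have "w * d \<in> mults 4 lipschitz" if "d \<in> Delta S" for d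
    using r(2)[OF that]
  proof
    assume "d \<in> mults 4 lipschitz"
    then show ?thesis using \<open>w \<in> lipschitz\<close> by (rule mults_mult_left[OF subring_R])
  next
    assume "cong_mod4_lipschitz d r"
    then have "w * (d - r) \<in> mults 4 lipschitz"
      unfolding cong_iff using \<open>w \<in> lipschitz\<close> by (rule mults_mult_left[OF subring_R])
    then have "w * (d - r) + w * r \<in> mults 4 lipschitz" using w(2) by (rule mults_add[OF subring_R])
    then show ?thesis by (simp flip: distrib_left)
  qed
  then show False using w(1) multiplier_contradiction[OF ring, of w] by auto
qed

lemma commutator:
  "lip a b c e * lip a' b' c' e' - lip a' b' c' e' * lip a b c e
    = 2 * lip 0 (c * e' - e * c') (e * b' - b * e') (b * c' - c * b')"
  using lip_ring_simps(4)[of 2 0 "c * e' - e * c'" "e * b' - b * e'" "b * c' - c * b'"]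
  by (simp add: lip_ring_simps)

text \<open>
  Since \<open>4 | \<Gamma>(S)\<close>, every difference is \<open>d = 2 d'\<close> with \<open>d'\<close> still Lipschitz. Multiplying \<open>w d\<close> by the
  conjugate of \<open>d'\<close> gives \<open>2 N(d') w\<close>, half of what \<open>N(d)\<close> itself would give; choosing
  \<open>N(d) / \<Gamma>(S)\<close> odd reaches half of \<open>\<Gamma>(S)\<close>.
\<close>

lemma half_Gamma_mult:
  assumes G: "Gamma S = 4 * g" and "g > 0" and w: "\<And>d. d \<in> Delta S \<Longrightarrow> w * d \<in> lipschitz"
  shows "of_nat (2 * g) * w \<in> lipschitz"
proof -
  note ring = is_subringD[OF subring_R]
  have "\<not> 8 * g dvd Gamma S" using G \<open>g > 0\<close> by (auto dest: dvd_imp_le)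
  then obtain d n where d: "d \<in> Delta S" "qnorm d = of_nat n" "\<not> 8 * g dvd n"
    using dvd_GammaI by blast
  have "int (Gamma S) dvd int n" using Gamma_dvd_norm[OF d(1), of "int n"] d(2) by simp
  then obtain k where k: "n = 4 * g * k" unfolding G int_dvd_int_iff by (rule dvdE)
  have "odd k" using d(3) unfolding k by (auto elim!: evenE)
  then obtain h where h: "k = 2 * h + 1" by (rule oddE)
  have "4 dvd int (Gamma S)" by (simp add: G)
  then obtain u v x where de: "d = lip 0 (2 * u) (2 * v) (2 * x)"
    using d(1) by (rule four_dvd_imp_Delta_even)
  let ?d = "lip 0 u v x"
  have d2: "d = 2 * ?d" using lip_ring_simps(4)[of 2 0 u v x] by (simp add: de)
  have "qnorm d = 4 * qnorm ?d"
    unfolding de qnorm_lip by (simp add: power_mult_distrib)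
  then have norm: "qnorm ?d = of_nat (g * k)" using d(2) k by simp
  have "(w * d) * qcnj ?d \<in> lipschitz"
    using w[OF d(1)] ring by simp
  moreover have "(w * d) * qcnj ?d = 2 * (w * (?d * qcnj ?d))"
    unfolding d2 mult_2 by (simp add: distrib_left distrib_right mult.assoc)
  moreover have "w * (?d * qcnj ?d) = of_nat (g * k) * w"
    unfolding mult_qcnj norm scalar_of_nat by (rule scalar_commutes[symmetric])
  ultimately have "2 * (of_nat (g * k) * w) \<in> lipschitz" by simp
  moreover have "2 * (of_nat (g * k) * w) = of_nat h * (of_nat (4 * g) * w) + of_nat (2 * g) * w"
  proof -
    have "2 * (of_nat (g * k) * w) = of_nat (2 * (g * k)) * w"
      by (simp only: of_nat_mult of_nat_numeral mult.assoc)
    also have "2 * (g * k) = h * (4 * g) + 2 * g" by (simp add: h algebra_simps)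
    also have "of_nat \<dots> * w = of_nat h * (of_nat (4 * g) * w) + of_nat (2 * g) * w"
      by (simp only: of_nat_add of_nat_mult distrib_right mult.assoc)
    finally show ?thesis .
  qed
  moreover have "of_nat h * (of_nat (4 * g) * w) \<in> lipschitz"
    using Gamma_right_mult[OF w] ring lip_in_R[of "int h" 0 0 0] of_int_eq_lip[of "int h"]
    unfolding G by simp
  ultimately show ?thesis using ring(4) by (metis add_diff_cancel_left')
qed

text \<open>
  Lipschitz commutators are divisible by 2, so a denominator 2 of \<open>w\<close> is harmless.
\<close>

lemma ringset_if_two_mult:
  assumes "\<And>w. (\<And>d. d \<in> Delta S \<Longrightarrow> w * d \<in> lipschitz) \<Longrightarrow> 2 * w \<in> lipschitz"
  shows "ringset lipschitz S"
proof (rule ringset_if_multipliers)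
  fix w r x
  assume w: "\<And>d. d \<in> Delta S \<Longrightarrow> w * d \<in> lipschitz" and r: "r \<in> lipschitz" and x: "x \<in> S"
  obtain a b c e where "r = lip a b c e" using r by (rule lipschitzE)
  moreover obtain a' b' c' e' where "x = lip a' b' c' e'" using x by (rule S_lipE)
  ultimately obtain z where z: "r * x - x * r = 2 * z" "z \<in> lipschitz"
    using commutator lip_in_lipschitz by blast
  have "w * (2 * z) = (2 * w) * z" unfolding mult_2 by (simp add: distrib_left distrib_right)
  then show "w * (r * x - x * r) \<in> lipschitz"
    using assms[OF w] z is_subringD(5)[OF subring_R] by simp
qed

lemma ringset_if_Gamma_2_or_4:
  assumes "Gamma S = 2 \<or> Gamma S = 4"
  shows "ringset lipschitz S"
  using assms
proof
  assume "Gamma S = 2"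
  then show ?thesis using Gamma_right_mult by (intro ringset_if_two_mult) simp
next
  assume "Gamma S = 4"
  then show ?thesis using half_Gamma_mult[of 1] by (intro ringset_if_two_mult) simp
qed

text \<open>
  Write \<open>d = y - z = 2 d'\<close>. Equality of the norms of \<open>y\<close> and \<open>z\<close> says that the inner product of \<open>z\<close>
  and \<open>d'\<close> is \<open>- N(d')\<close>, which is even as 8 divides \<open>N(d)\<close>. All elements of \<open>S\<close> are congruent
  modulo 2, so the same parity holds with any other element in place of \<open>z\<close>, and with any vector
  congruent to \<open>d'\<close> modulo 2 in place of \<open>d'\<close>.
\<close>

lemma imag_even_inner:
  assumes dvd: "8 dvd int (Gamma S)" and d: "d \<in> Delta S"
    and cong: "cong_mod4_lipschitz d (lip 0 (2 * i) (2 * j) (2 * k))"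
    and x: "lip a b c e \<in> S"
  shows "even (b * i + c * j + e * k)"
proof -
  obtain u v w where dl: "d = lip 0 (2 * u) (2 * v) (2 * w)" and uvw: "even (u + v + w)"
    using dvd d by (rule eight_dvd_imp_Delta)
  obtain y z where yz: "y \<in> S" "z \<in> S" "d = y - z" using d unfolding Delta_def by blast
  obtain a' b' c' e' where z: "z = lip a' b' c' e'" using yz(2) by (rule S_lipE)
  have "y = d + z" using yz(3) by simp
  then have y: "y = lip a' (2 * u + b') (2 * v + c') (2 * w + e')"
    by (simp add: dl z lip_ring_simps)
  have "(2 * u + b')\<^sup>2 + (2 * v + c')\<^sup>2 + (2 * w + e')\<^sup>2 = b'\<^sup>2 + c'\<^sup>2 + e'\<^sup>2"
    using norm_eq(2)[OF yz(1)[unfolded y] yz(2)[unfolded z]] .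
  then have "4 * (b' * u + c' * v + e' * w) = 4 * - (u\<^sup>2 + v\<^sup>2 + w\<^sup>2)"
    by (simp add: power2_eq_square algebra_simps)
  then have "b' * u + c' * v + e' * w = - (u\<^sup>2 + v\<^sup>2 + w\<^sup>2)"
    by (simp only: mult_cancel_left) simp
  then have inner: "even (b' * u + c' * v + e' * w)" using uvw by auto
  have "lip a b c e - z \<in> Delta S" using x yz(2) by (rule diff_in_Delta)
  then obtain u' v' w' where "lip a b c e - z = lip 0 (2 * u') (2 * v') (2 * w')"
    using eight_dvd_imp_Delta[OF dvd] by blast
  then have "b = b' + 2 * u'" "c = c' + 2 * v'" "e = e' + 2 * w'"
    unfolding z lip_ring_simps by simp_all
  then have par: "even b = even b'" "even c = even c'" "even e = even e'" by simp_all
  have "4 dvd 2 * u - 2 * i" "4 dvd 2 * v - 2 * j" "4 dvd 2 * w - 2 * k"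
    using cong unfolding dl cong_iff lip_ring_simps lip_in_mults_lipschitz by simp_all
  then have "even u = even i" "even v = even j" "even w = even k" by presburger+
  with inner par show ?thesis by simp
qed

text \<open>
  Put \<open>c = 4 w\<close>. Each residue \<open>r\<close> satisfies \<open>c r \<in> 4 L\<close>, and two of them together force all
  coordinates of \<open>c\<close> to have the same parity; the same two residues do this for the imaginary
  coordinates of \<open>x\<close>. Half a commutator \<open>z\<close> with \<open>x\<close> then has even coordinate sum, and modulo 2 each
  coordinate of \<open>c z\<close> is a multiple of that sum.
\<close>

lemma ringset_if_condition:
  assumes G: "Gamma S = 8" and d1: "d1 \<in> Delta S" and d2: "d2 \<in> Delta S"
    and r: "r1 \<in> {lip 0 2 2 0, lip 0 2 0 2, lip 0 0 2 2}" "r2 \<in> {lip 0 2 2 0, lip 0 2 0 2, lip 0 0 2 2}"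
      "r1 \<noteq> r2"
    and cong: "cong_mod4_lipschitz d1 r1" "cong_mod4_lipschitz d2 r2"
  shows "ringset lipschitz S"
proof (rule ringset_if_multipliers)
  fix w r x
  assume w: "\<And>d. d \<in> Delta S \<Longrightarrow> w * d \<in> lipschitz" and "r \<in> lipschitz" and x: "x \<in> S"
  have "of_nat (2 * 2) * w \<in> lipschitz"
    by (rule half_Gamma_mult) (use G w in auto)
  then have c4: "4 * w \<in> lipschitz" by simp
  then obtain c0 c1 c2 c3 where c: "4 * w = lip c0 c1 c2 c3" by (rule lipschitzE)
  have cr: "lip c0 c1 c2 c3 * \<rho> \<in> mults 4 lipschitz"
    if d: "d \<in> Delta S" "cong_mod4_lipschitz d \<rho>" for d \<rho>
  proof -
    have "4 * w * d \<in> mults 4 lipschitz"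
      using w[OF d(1)] by (intro multsI[of _ 4 "w * d"]) (simp_all add: mult.assoc)
    moreover have "4 * w * (d - \<rho>) \<in> mults 4 lipschitz"
      using d(2) c4 unfolding cong_iff by (rule mults_mult_left[OF subring_R])
    ultimately have "4 * w * d - 4 * w * (d - \<rho>) \<in> mults 4 lipschitz" by (rule mults_diff[OF subring_R])
    then show ?thesis by (simp add: right_diff_distrib c)
  qed
  have c_par: "even (c0 - c1) \<and> even (c1 - c2) \<and> even (c2 - c3)"
    using r cr[OF d1 cong(1)] cr[OF d2 cong(2)]
    by (simp only: insert_iff empty_iff simp_thms, elim disjE;
        simp add: lip_ring_simps lip_in_mults_lipschitz; presburger)
  obtain x0 x1 x2 x3 where xl: "x = lip x0 x1 x2 x3" using x by (rule S_lipE)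
  have dvd: "8 dvd int (Gamma S)" by (simp add: G)
  have inner_ij: "even (x1 + x2)" if "d \<in> Delta S" "cong_mod4_lipschitz d (lip 0 2 2 0)" for d
    using imag_even_inner[OF dvd that(1) _ x[unfolded xl], of 1 1 0] that(2) by simp
  have inner_ik: "even (x1 + x3)" if "d \<in> Delta S" "cong_mod4_lipschitz d (lip 0 2 0 2)" for d
    using imag_even_inner[OF dvd that(1) _ x[unfolded xl], of 1 0 1] that(2) by simp
  have inner_jk: "even (x2 + x3)" if "d \<in> Delta S" "cong_mod4_lipschitz d (lip 0 0 2 2)" for d
    using imag_even_inner[OF dvd that(1) _ x[unfolded xl], of 0 1 1] that(2) by simp
  have x_par: "even (x1 - x2) \<and> even (x2 - x3)"
    using r cong inner_ij[OF d1] inner_ik[OF d1] inner_jk[OF d1] inner_ij[OF d2] inner_ik[OF d2] inner_jk[OF d2]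
    by auto
  obtain r0 r1 r2 r3 where rl: "r = lip r0 r1 r2 r3" using \<open>r \<in> lipschitz\<close> by (rule lipschitzE)
  let ?z = "lip 0 (r2 * x3 - r3 * x2) (r3 * x1 - r1 * x3) (r1 * x2 - r2 * x1)"
  have "lip c0 c1 c2 c3 * ?z \<in> mults 2 lipschitz"
    unfolding lip_ring_simps lip_in_mults_lipschitz using c_par x_par by auto
  then obtain y where y: "y \<in> lipschitz" "4 * w * ?z = 2 * y"
    unfolding c by (auto elim: multsE)
  have "2 * (w * (2 * ?z)) = 4 * w * ?z"
  proof -
    have "(4::rquat) = 2 + 2" by simp
    then show ?thesis by (simp only: mult_2 distrib_left distrib_right)
  qed
  then have "w * (2 * ?z) = y" using y(2) by (metis two_times_cancel)
  then show "w * (r * x - x * r) \<in> lipschitz" using y(1) by (simp add: rl xl commutator)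
qed

lemma ringset_iff:
  "ringset lipschitz S \<longleftrightarrow> Gamma S = 2 \<or> Gamma S = 4 \<or> (Gamma S = 8 \<and>
    (\<exists>d1\<in>Delta S. \<exists>d2\<in>Delta S.
      \<exists>r1\<in>{lip 0 2 2 0, lip 0 2 0 2, lip 0 0 2 2}. \<exists>r2\<in>{lip 0 2 2 0, lip 0 2 0 2, lip 0 0 2 2}.
        r1 \<noteq> r2 \<and> cong_mod4_lipschitz d1 r1 \<and> cong_mod4_lipschitz d2 r2))"
  (is "_ \<longleftrightarrow> _ \<or> _ \<or> (_ \<and> ?C)")
proof
  assume ring: "ringset lipschitz S"
  have "\<not> 2 ^ 4 dvd Gamma S"
    using sixteen_not_dvd_Gamma[OF ring] int_dvd_int_iff[of 16 "Gamma S"] by simp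
  moreover have "\<not> p dvd Gamma S" if "prime p" "odd p" for p
    using odd_prime_not_dvd_Gamma[OF ring, of "int p"] that int_dvd_int_iff[of p "Gamma S"] by simp
  ultimately obtain k where k: "k < 4" "Gamma S = 2 ^ k"
    using nat_cases_no_odd_prime by blast
  from k(1) have "k = 0 \<or> k = 1 \<or> k = 2 \<or> k = 3" by auto
  moreover have ?C if "k = 3"
    using condition_if_eight_dvd[OF ring] k(2) that by simp
  ultimately show "Gamma S = 2 \<or> Gamma S = 4 \<or> (Gamma S = 8 \<and> ?C)"
    using k(2) two_dvd_Gamma by fastforce
next
  assume "Gamma S = 2 \<or> Gamma S = 4 \<or> (Gamma S = 8 \<and> ?C)"
  then show "ringset lipschitz S"
    using ringset_if_Gamma_2_or_4 ringset_if_condition by blast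
qed

end

theorem theorem1p10:
  fixes R S :: "rquat set"
  assumes "R = lipschitz \<or> R = hurwitz"
    and "S \<subset> R"
    and "reduced R S"
    and "infinite S \<or> card S \<ge> 2"
  shows "(R = lipschitz \<longrightarrow>
           (ringset R S \<longleftrightarrow>
              Gamma S = 2 \<or> Gamma S = 4 \<or>
              (Gamma S = 8 \<and>
                (\<exists>d1\<in>Delta S. \<exists>d2\<in>Delta S.
                  \<exists>r1\<in>{2 * qi + 2 * qj, 2 * qi + 2 * qk, 2 * qj + 2 * qk}.
                  \<exists>r2\<in>{2 * qi + 2 * qj, 2 * qi + 2 * qk, 2 * qj + 2 * qk}.
                    r1 \<noteq> r2 \<and> cong_mod4_lipschitz d1 r1 \<and> cong_mod4_lipschitz d2 r2)))) \<and>
         (R = hurwitz \<longrightarrow> (ringset R S \<longleftrightarrow> Gamma S = 1 \<or> Gamma S = 2))"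
proof (intro conjI impI)
  assume "R = lipschitz"
  then interpret reduced_lipschitz S
    using assms(3) by unfold_locales auto
  show "ringset R S \<longleftrightarrow>
      Gamma S = 2 \<or> Gamma S = 4 \<or>
      (Gamma S = 8 \<and>
        (\<exists>d1\<in>Delta S. \<exists>d2\<in>Delta S.
          \<exists>r1\<in>{2 * qi + 2 * qj, 2 * qi + 2 * qk, 2 * qj + 2 * qk}.
          \<exists>r2\<in>{2 * qi + 2 * qj, 2 * qi + 2 * qk, 2 * qj + 2 * qk}.
            r1 \<noteq> r2 \<and> cong_mod4_lipschitz d1 r1 \<and> cong_mod4_lipschitz d2 r2))"
    unfolding residues \<open>R = lipschitz\<close> by (rule ringset_iff)
next
  assume "R = hurwitz"
  then interpret reduced_hurwitz S
    using assms(3) by unfold_locales auto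
  show "ringset R S \<longleftrightarrow> Gamma S = 1 \<or> Gamma S = 2"
    unfolding \<open>R = hurwitz\<close> by (rule ringset_iff)
qed

end
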